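(* Let $\mathbb{F}_q$ be a finite field and let $s_1,s_2,s_3\in\mathbb{F}_q[t]\setminus\{0\}$ with $s_1+s_2+s_3=0$. (a) If $A\subseteq\mathbb{F}_q[t]$ satisfies $\overline{d}(A):=\limsup_{N\to\infty}\frac{|\{x\in A:\deg x<N\}|}{q^N}=\delta>0$, then $s_1A+s_2A+s_3A$ contains an $\mathbb{F}_q$-vector subspace of $\mathbb{F}_q[t]$ of finite codimension, where the codimension depends only on $s_1,s_2,s_3$ and $\delta$. (b) If $\mathbb{F}_q[t]=\bigcup_{i=1}^r A_i$, then for some $i\in\{1,\ldots,r\}$, $s_1A_i-s_1A_i+s_2A_i$ contains an $\mathbb{F}_q$-vector subspace of $\mathbb{F}_q[t]$ of finite codimension, where the codimension depends only on $s_1,s_2$ and $r$. (c) If $\mathbb{F}_q[t]=\bigcup_{i=1}^r A_i$, then there exists $i\in\{1,\ldots,r\}$ such that $A_i-A_i+sA_i$ contains an $\mathbb{F}_q$-vector subspace of $\mathbb{F}_q[t]$ of finite codimension for every $s\in\mathbb{F}_q[t]\setminus\{0\}$.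
   Context: For $c\in\mathbb{F}_q[t]$ and $A\subseteq\mathbb{F}_q[t]$, $cA=\{ca:a\in A\}$ (polynomial multiplication) and $A\pm B=\{a\pm b: a\in A, b\in B\}$. *)

theory Defs
  imports
    Complex_Main
    "HOL-Library.Cardinality"
    "HOL-Library.Extended_Real"
    "HOL-Library.Set_Algebras"
    "HOL-Computational_Algebra.Polynomial"
begin

text \<open>
  Throughout, \<open>F\<^sub>q\<close> is a type of sort \<open>{field, finite}\<close>, so that \<open>q = CARD('a)\<close>, and
  \<open>F\<^sub>q[t]\<close> is \<open>'a poly\<close>, a vector space over \<open>'a\<close> via \<^const>\<open>smult\<close>.
  The dilate \<open>cA\<close> and the sumset \<open>A + B\<close> are \<open>c *o A\<close> and \<open>A + B\<close> from
  \<^theory>\<open>HOL-Library.Set_Algebras\<close>.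
\<close>

interpretation poly_vs: vector_space "smult :: 'a::field \<Rightarrow> 'a poly \<Rightarrow> 'a poly"
  by unfold_locales (simp_all add: smult_add_left smult_add_right)

text \<open>The operation \<open>-\<close> on sets is the set-theoretic difference, hence a separate notation.\<close>

definition set_minus :: "'a::minus set \<Rightarrow> 'a set \<Rightarrow> 'a set"  (infixl \<open>-\<^sub>S\<close> 65)
  where "A -\<^sub>S B = {c. \<exists>a\<in>A. \<exists>b\<in>B. c = a - b}"

text \<open>
  The disjunct \<open>x = 0\<close> implements the convention \<open>deg 0 = -\<infinity>\<close>, whereas
  \<^term>\<open>degree 0 = 0\<close>.
\<close>

definition upper_density :: "'a::{field,finite} poly set \<Rightarrow> ereal"
  where "upper_density A =
    limsup (\<lambda>N. ereal (real (card {x \<in> A. x = 0 \<or> degree x < N}) / real CARD('a) ^ N))"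

text \<open>
  \<open>V\<close> is a linear subspace with \<open>dim (F\<^sub>q[t] / V) = k\<close>: the quotient has a basis consisting of
  the classes of the \<open>k\<close> elements of \<open>B\<close>, that is, \<open>span B\<close> is a \<open>k\<close>-dimensional complement of \<open>V\<close>.
\<close>

definition has_codim :: "'a::field poly set \<Rightarrow> nat \<Rightarrow> bool"
  where "has_codim V k \<longleftrightarrow>
    poly_vs.subspace V \<and>
    (\<exists>B. finite B \<and> card B = k \<and> poly_vs.independent B \<and>
         poly_vs.span B \<inter> V = {0} \<and> poly_vs.span B + V = UNIV)"

end

theory Submission
  imports
    Defs
    "HOL-Library.FuncSet"
    "HOL-Library.Indicator_Function"
    "HOL-Library.Infinite_Set"
    "HOL-Library.Nat_Bijection"
    "HOL-Number_Theory.Cong"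
begin

text \<open>
  Inside a box of polynomials of degree less than \<open>N\<close>, let \<open>R x\<close> be the number of solutions of
  \<open>s\<^sub>1 a + s\<^sub>2 b + s\<^sub>3 c = x\<close> in \<open>A\<close>. If \<open>R 0\<close> is at least a fixed proportion of \<open>q\<^bsup>2N\<^esup>\<close>, then
  \<open>R x > 0\<close> whenever all characters in the large spectrum of \<open>A\<close> are trivial at \<open>x\<close>, and by
  Plancherel the size of the large spectrum is bounded independently of \<open>N\<close>; letting \<open>N\<close> tend to
  infinity gives a subspace of bounded codimension. It remains to bound \<open>R 0\<close> from below. For (a) this
  is Roth's theorem by density increment, with Varnavides' averaging; the increments can be taken on
  exact copies \<open>c + u \<cdot> poly_below M\<close> of smaller boxes. For (b) and (c) the equation is
  \<open>p\<^sub>i a - p\<^sub>i b + s\<^sub>i c = 0\<close>, with coefficients depending on the colour \<open>i\<close>: some colour contains a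
  solution, by induction on the number of colours, and a multidimensional version of this statement
  can be averaged. For (c), \<open>s\<^sub>i\<close> is chosen as a counterexample for the colour \<open>i\<close>.
\<close>

section \<open>Additive characters\<close>

text \<open>Counting a proportion of q^(2N) solutions needs a family of configurations with two free
  parameters. If the coefficients sum to 0, the maps x -> c + u x preserve the equation and provide
  them. For p a - p b + s c = 0 the coefficients sum to s \<noteq> 0, so only the dilations x -> u x
  are left, a family too small by a factor of about q^N. Therefore the induction on colours is done
  for vectors over F_q[t]: specialising two independent vectors \<open>b\<close>, \<open>y\<close>
  at all points of a box again gives two free parameters. The codimension has to be fixed before
  \<open>A\<close>, so every bound must be uniform in N. Moreover the counts are available only for
  infinitely many N, and the subspaces found in different boxes need not be nested; hence the
  functionals, rather than the subspaces, are carried to a limit. As \<open>has_codim\<close>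
  prescribes the codimension exactly, conditions that happen to be redundant are padded by
  others.\<close>

lemma card_field_ge_2: "CARD('a::{field,finite}) \<ge> 2"
proof -
  have "card {0, 1 :: 'a} \<le> CARD('a)"
    by (rule card_mono) auto
  then show ?thesis
    by simp
qed

text \<open>In place of the trace: an additive subgroup \<open>H\<close> maximal among those
  omitting 1 is a complement of the prime field. Each \<open>x\<close> is congruent modulo
  \<open>H\<close> to a natural number n, unique modulo the characteristic p, and is sent to exp(2
  pi i n / p).\<close>

lemma exists_additive_character:
  "\<exists>\<psi> :: 'a::{field,finite} \<Rightarrow> complex.
     (\<forall>x y. \<psi> (x + y) = \<psi> x * \<psi> y) \<and> (\<forall>x. norm (\<psi> x) = 1) \<and> (\<exists>x. \<psi> x \<noteq> 1)"
proof -
  define p where "p = CHAR('a)"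
  have p_pos: "p > 0"
    unfolding p_def by (rule finite_imp_CHAR_pos) simp
  then have p: "prime p"
    unfolding p_def using prime_CHAR_semidom by blast
  have of_nat_p: "of_nat p = (0::'a)"
    by (simp add: p_def)
  have inverse_of_nat: "\<exists>j. of_nat j * of_nat k = (1::'a)" if "of_nat k \<noteq> (0::'a)" for k
  proof -
    have "\<not> p dvd k"
      using that by (simp add: p_def of_nat_eq_0_iff_char_dvd)
    then have "coprime k p"
      using p prime_imp_coprime[of p k] by (simp add: coprime_commute)
    moreover have "k \<noteq> 0"
      using that by (metis of_nat_0)
    ultimately obtain x y where "k * x = p * y + 1"
      using bezout_nat[of k p] by auto
    then have "of_nat k * of_nat x = (of_nat p * of_nat y + 1 :: 'a)"
      by (metis of_nat_1 of_nat_add of_nat_mult)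
    then show ?thesis
      using of_nat_p by (auto simp: mult.commute)
  qed
  \<comment> \<open>Only 0 and sums are required; in characteristic p a negative is a (p - 1)-fold
    sum.\<close>
  define closed where
    "closed H \<longleftrightarrow> 0 \<in> H \<and> (\<forall>x\<in>H. \<forall>y\<in>H. x + y \<in> H) \<and> 1 \<notin> H" for H :: "'a set"
  have "closed {0}"
    by (simp add: closed_def)
  then obtain H where H: "closed H" and max: "\<And>H'. closed H' \<Longrightarrow> H \<subseteq> H' \<Longrightarrow> H = H'"
    using finite_has_maximal[of "Collect closed"] by (auto intro: finite_subset)
  have zero: "0 \<in> H" and add: "x \<in> H \<Longrightarrow> y \<in> H \<Longrightarrow> x + y \<in> H" and one: "1 \<notin> H" for x y
    using H by (auto simp: closed_def)
  have mult: "of_nat k * x \<in> H" if "x \<in> H" for k x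
    by (induction k) (use that zero add in \<open>auto simp: distrib_right add.commute\<close>)
  have neg: "- x \<in> H" if "x \<in> H" for x
  proof -
    have "of_nat (p - 1) * x + x = of_nat (Suc (p - 1)) * x"
      by (simp only: of_nat_Suc distrib_right mult_1_left add.commute)
    also have "\<dots> = 0"
      using p_pos of_nat_p by simp
    finally show ?thesis
      using mult[OF that, of "p - 1"] by (simp add: eq_neg_iff_add_eq_0[symmetric])
  qed
  have of_nat_in: "of_nat m = (0::'a)" if "of_nat m \<in> H" for m
    using inverse_of_nat[of m] mult[OF that] one by metis
  \<comment> \<open>For \<open>x\<close> outside \<open>H\<close>, maximality puts 1 into the sums
    of \<open>H\<close> and multiples of \<open>x\<close>; dividing by the multiplier of
    \<open>x\<close> shows that \<open>x\<close> is congruent to a natural number.\<close>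
  have rep: "\<exists>n. x - of_nat n \<in> H" for x
  proof (cases "x \<in> H")
    case True
    then show ?thesis
      by (intro exI[of _ 0]) simp
  next
    case False
    define H' where "H' = {h + of_nat k * x | h k. h \<in> H}"
    have "x \<in> H'"
      unfolding H'_def using zero by (intro CollectI exI[of _ 0] exI[of _ 1]) simp
    moreover have "H \<subseteq> H'"
      unfolding H'_def by (intro subsetI CollectI exI exI[of _ 0]) simp
    ultimately have "\<not> closed H'"
      using max False by blast
    moreover have "0 \<in> H'"
      using zero \<open>H \<subseteq> H'\<close> by blast
    moreover have "u + v \<in> H'" if "u \<in> H'" "v \<in> H'" for u v
    proof -
      from that obtain h k h' k' where "u = h + of_nat k * x" "v = h' + of_nat k' * x" "h \<in> H" "h' \<in> H"
        by (auto simp: H'_def)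
      then have "u + v = (h + h') + of_nat (k + k') * x" "h + h' \<in> H"
        by (auto simp: algebra_simps add)
      then show ?thesis
        unfolding H'_def by blast
    qed
    ultimately have "1 \<in> H'"
      by (auto simp: closed_def)
    then obtain h k where h: "h \<in> H" "1 = h + of_nat k * x"
      by (auto simp: H'_def)
    then have "of_nat k \<noteq> (0::'a)"
      using one by auto
    then obtain j where j: "of_nat j * of_nat k = (1::'a)"
      using inverse_of_nat by blast
    have "of_nat j * 1 = of_nat j * h + of_nat j * of_nat k * x"
      by (subst h(2)) (simp add: algebra_simps)
    then have "x - of_nat j = of_nat j * (- h)"
      using j by (simp add: algebra_simps)
    then show ?thesis
      using mult[OF neg[OF h(1)], of j] by (intro exI[of _ j]) simp
  qed
  define n where "n x = (SOME n. x - of_nat n \<in> H)" for x :: 'a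
  have n: "x - of_nat (n x) \<in> H" for x
    unfolding n_def by (rule someI_ex[OF rep])
  define E where "E m = cis (2 * pi / p) ^ m" for m :: nat
  have E_p: "E p = 1"
    using p_pos by (simp add: E_def DeMoivre)
  have E_mod: "E m = E (m mod p)" for m
  proof -
    have "E m = E (p * (m div p) + m mod p)"
      by simp
    also have "\<dots> = E p ^ (m div p) * E (m mod p)"
      by (simp only: E_def power_add power_mult)
    finally show ?thesis
      by (simp add: E_p)
  qed
  have E_cong: "E m = E m'" if "of_nat m - of_nat m' \<in> H" for m m'
  proof -
    \<comment> \<open>The natural number m + (p - 1) m' stands for the difference m - m', so that
      \<open>of_nat_in\<close> applies.\<close>
    have "of_nat (m + (p - 1) * m') = (of_nat m - of_nat m' :: 'a)"
      using p_pos of_nat_p by (simp add: of_nat_diff Suc_leI)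
    then have "of_nat m = (of_nat m' :: 'a)"
      using of_nat_in[of "m + (p - 1) * m'"] that by simp
    then have "m mod p = m' mod p"
      by (metis cong_def of_nat_eq_iff_cong_CHAR p_def)
    then show ?thesis
      using E_mod by metis
  qed
  define \<psi> where "\<psi> x = E (n x)" for x
  have "\<psi> (x + y) = \<psi> x * \<psi> y" for x y
  proof -
    have "of_nat (n (x + y)) - of_nat (n x + n y)
        = (x - of_nat (n x)) + (y - of_nat (n y)) + - ((x + y) - of_nat (n (x + y)))"
      by simp
    also have "\<dots> \<in> H"
      by (intro add neg n)
    finally have "E (n (x + y)) = E (n x + n y)"
      by (rule E_cong)
    then show ?thesis
      by (simp add: \<psi>_def E_def power_add)
  qed
  moreover have "norm (\<psi> x) = 1" for x
    by (simp add: \<psi>_def E_def norm_power)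
  moreover have "\<psi> 1 \<noteq> 1"
  proof -
    have "of_nat (n 1) - of_nat 1 \<in> H"
      using neg[OF n[of 1]] by simp
    then have "\<psi> 1 = E 1"
      unfolding \<psi>_def by (rule E_cong)
    \<comment> \<open>p \<ge> 2 keeps 2 pi / p in the interval up to pi, where cos is strictly
      decreasing.\<close>
    moreover have "cos (2 * pi / p) < cos 0"
      using p_pos prime_ge_2_nat[OF p]
      by (intro cos_monotone_0_pi) (auto simp: field_simps)
    ultimately show ?thesis
      by (auto simp: E_def complex_eq_iff)
  qed
  ultimately show ?thesis
    by blast
qed

definition additive_character :: "'a::{field,finite} \<Rightarrow> complex"
  where "additive_character = (SOME \<psi>. (\<forall>x y. \<psi> (x + y) = \<psi> x * \<psi> y) \<and>
    (\<forall>x. norm (\<psi> x) = 1) \<and> (\<exists>x. \<psi> x \<noteq> 1))"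

lemma
  fixes x y :: "'a::{field,finite}"
  shows additive_character_add: "additive_character (x + y) = additive_character x * additive_character y"
    and norm_additive_character: "norm (additive_character x) = 1"
    and additive_character_nontrivial: "\<exists>x::'a::{field,finite}. additive_character x \<noteq> 1"
proof -
  have "(\<forall>x y::'a. additive_character (x + y) = additive_character x * additive_character y) \<and>
    (\<forall>x::'a. norm (additive_character x) = 1) \<and> (\<exists>x::'a. additive_character x \<noteq> 1)"
    unfolding additive_character_def by (rule someI_ex[OF exists_additive_character])
  then show "additive_character (x + y) = additive_character x * additive_character y"
    and "norm (additive_character x) = 1" and "\<exists>x::'a. additive_character x \<noteq> 1"
    by blast+
qed

lemma additive_character_0 [simp]: "additive_character 0 = 1"
proof -
  have "additive_character (0::'a) = additive_character (0::'a) * additive_character (0::'a)"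
    using additive_character_add[of "0::'a" 0, unfolded add_0_left] .
  then have "additive_character (0::'a) = 0 \<or> additive_character (0::'a) = 1"
    by (rule mult_cancel_left1[THEN iffD1])
  then show ?thesis
    using norm_additive_character[of "0::'a"] by auto
qed

lemma additive_character_minus: "additive_character (- x) = cnj (additive_character x)"
proof -
  have "additive_character x * additive_character (- x) = 1"
    by (simp flip: additive_character_add)
  moreover have "additive_character x * cnj (additive_character x) = 1"
    by (simp add: complex_norm_square[symmetric] norm_additive_character)
  ultimately show ?thesis
    by (metis mult_cancel_left mult_zero_left zero_neq_one)
qed

section \<open>Fourier analysis on boxes of polynomials\<close>

definition poly_below :: "nat \<Rightarrow> 'a::zero poly set"
  where "poly_below N = {x. \<forall>j\<ge>N. coeff x j = 0}"

lemma poly_below_iff: "x \<in> poly_below N \<longleftrightarrow> x = 0 \<or> degree x < N"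
proof
  assume "x \<in> poly_below N"
  then have "coeff x (degree x) = 0" if "N \<le> degree x"
    using that by (simp add: poly_below_def)
  then show "x = 0 \<or> degree x < N"
    by (auto simp: not_le)
qed (auto simp: poly_below_def coeff_eq_0)

lemma poly_below_0 [simp]: "0 \<in> poly_below N"
  by (simp add: poly_below_def)

lemma poly_below_add: "x \<in> poly_below N \<Longrightarrow> y \<in> poly_below N \<Longrightarrow> x + y \<in> poly_below N"
  by (simp add: poly_below_def)

lemma poly_below_diff:
  "x \<in> poly_below N \<Longrightarrow> y \<in> poly_below N \<Longrightarrow> x - y \<in> poly_below N" for x :: "'a::ab_group_add poly"
  by (simp add: poly_below_def)

lemma poly_below_sum: "(\<And>i. i \<in> I \<Longrightarrow> f i \<in> poly_below N) \<Longrightarrow> sum f I \<in> poly_below N"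
  by (simp add: poly_below_def coeff_sum)

lemma poly_below_mono: "M \<le> N \<Longrightarrow> poly_below M \<subseteq> poly_below N"
  by (auto simp: poly_below_def)

lemma poly_below_mult:
  "degree s \<le> D \<Longrightarrow> x \<in> poly_below N \<Longrightarrow> D + N \<le> K \<Longrightarrow> s * x \<in> poly_below K"
  for x :: "'a::idom poly"
  by (cases "s * x = 0") (auto simp: poly_below_iff degree_mult_eq)

lemma poly_below_Suc: "poly_below (Suc N) = (\<lambda>(a, x). pCons a x) ` (UNIV \<times> poly_below N)"
proof safe
  fix x :: "'a poly" assume "x \<in> poly_below (Suc N)"
  then show "x \<in> (\<lambda>(a, x). pCons a x) ` (UNIV \<times> poly_below N)"
    by (cases x) (force simp: poly_below_def)
next
  fix a and x :: "'a poly" assume "x \<in> poly_below N"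
  then show "pCons a x \<in> poly_below (Suc N)"
    by (auto simp: poly_below_def coeff_pCons split: nat.splits)
qed

lemma card_poly_below: "card (poly_below N :: 'a::{zero,finite} poly set) = CARD('a) ^ N"
  and finite_poly_below [simp]: "finite (poly_below N :: 'a::{zero,finite} poly set)"
proof (induction N)
  case 0
  have *: "poly_below 0 = {0 :: 'a poly}"
    by (auto simp: poly_below_iff)
  show "card (poly_below 0 :: 'a poly set) = CARD('a) ^ 0"
    and "finite (poly_below 0 :: 'a poly set)"
    unfolding * by simp_all
next
  case (Suc N)
  have *: "inj_on (\<lambda>(a :: 'a, x). pCons a x) (UNIV \<times> poly_below N)"
    by (auto simp: inj_on_def)
  show "card (poly_below (Suc N) :: 'a poly set) = CARD('a) ^ Suc N"
    unfolding poly_below_Suc card_image[OF *] card_cartesian_product Suc by simp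
  show "finite (poly_below (Suc N) :: 'a poly set)"
    unfolding poly_below_Suc by (intro finite_imageI finite_cartesian_product Suc) simp
qed

text \<open>A finite version of the residue pairing: (h, x) -> \<open>coeff (h * x) L\<close> is a
  perfect pairing on \<open>poly_below (Suc L)\<close>, so \<open>h\<close> in that box runs through
  all characters of its additive group.\<close>

definition poly_char :: "nat \<Rightarrow> 'a::{field,finite} poly \<Rightarrow> 'a poly \<Rightarrow> complex"
  where "poly_char L h x = additive_character (coeff (h * x) L)"

lemma norm_poly_char [simp]: "norm (poly_char L h x) = 1"
  by (simp add: poly_char_def norm_additive_character)

lemma poly_char_add_left: "poly_char L (h + g) x = poly_char L h x * poly_char L g x"
  and poly_char_add_right: "poly_char L h (x + y) = poly_char L h x * poly_char L h y"
  and poly_char_minus: "poly_char L h (- x) = cnj (poly_char L h x)"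
  by (simp_all add: poly_char_def algebra_simps additive_character_add additive_character_minus)

lemma poly_char_0 [simp]: "poly_char L h 0 = 1"
  by (simp add: poly_char_def)

text \<open>Replacing \<open>h\<close> by \<open>h + g\<close> permutes the box and multiplies the
  sum by the value of \<open>g\<close> at \<open>x\<close>, which can be made different from 1
  unless \<open>x = 0\<close>.\<close>

lemma sum_poly_char:
  fixes x :: "'a::{field,finite} poly"
  assumes "x \<in> poly_below (Suc L)"
  shows "(\<Sum>h\<in>poly_below (Suc L). poly_char L h x)
    = (if x = 0 then of_nat (CARD('a) ^ Suc L) else 0)"
proof (cases "x = 0")
  case False
  obtain z :: 'a where z: "additive_character z \<noteq> 1"
    using additive_character_nontrivial by blast
  define j where "j = degree x"
  have j: "j \<le> L"
    using assms False by (simp add: poly_below_iff j_def)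
  \<comment> \<open>Moves the leading coefficient of \<open>x\<close> to position \<open>L\<close>
    and scales it to \<open>z\<close>.\<close>
  define g where "g = monom (z / coeff x j) (L - j)"
  have g: "g \<in> poly_below (Suc L)"
    using j by (auto simp: g_def poly_below_def)
  have "coeff (g * x) L = z"
    using False j by (simp add: g_def coeff_monom_mult j_def)
  then have char_g: "poly_char L g x \<noteq> 1"
    using z by (simp add: poly_char_def)
  have "(\<Sum>h\<in>poly_below (Suc L). poly_char L h x) = (\<Sum>h\<in>poly_below (Suc L). poly_char L (h + g) x)"
    by (rule sum.reindex_bij_witness[of _ "\<lambda>h. h + g" "\<lambda>h. h - g"])
      (use g in \<open>auto intro: poly_below_add poly_below_diff\<close>)
  also have "\<dots> = (\<Sum>h\<in>poly_below (Suc L). poly_char L h x) * poly_char L g x"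
    by (simp add: poly_char_add_left sum_distrib_right)
  finally have "(\<Sum>h\<in>poly_below (Suc L). poly_char L h x) = 0"
    using char_g mult_cancel_left1[THEN iffD1] by blast
  then show ?thesis
    unfolding if_not_P[OF False] .
next
  case True
  then show ?thesis
    by (simp add: card_poly_below)
qed

text \<open>The dilation by \<open>s\<close> is built in, so that one frequency \<open>h\<close>
  serves all three coefficients of the equation; the value is the plain transform of
  \<open>f\<close> at \<open>h * s\<close>.\<close>

definition fourier :: "nat \<Rightarrow> nat \<Rightarrow> ('a::{field,finite} poly \<Rightarrow> complex) \<Rightarrow> 'a poly \<Rightarrow> 'a poly \<Rightarrow> complex"
  where "fourier N L f s h = (\<Sum>a\<in>poly_below N. f a * poly_char L h (s * a))"

definition weighted_solutions ::
  "nat \<Rightarrow> 'a::{field,finite} poly \<Rightarrow> 'a poly \<Rightarrow> 'a poly \<Rightarrow>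
    ('a poly \<Rightarrow> complex) \<Rightarrow> ('a poly \<Rightarrow> complex) \<Rightarrow> ('a poly \<Rightarrow> complex) \<Rightarrow> 'a poly \<Rightarrow> complex"
  where "weighted_solutions N s1 s2 s3 f1 f2 f3 x =
    (\<Sum>(a, b, c)\<in>poly_below N \<times> poly_below N \<times> poly_below N.
      if s1 * a + s2 * b + s3 * c = x then f1 a * f2 b * f3 c else 0)"

text \<open>\<open>D + N \<le> Suc L\<close> makes room for \<open>s1 * a + s2 * b + s3 * c\<close>
  in the box of frequencies, so orthogonality detects equality itself, without wrap-around.\<close>

lemma fourier_inversion:
  fixes s1 s2 s3 :: "'a::{field,finite} poly"
  assumes "degree s1 \<le> D" "degree s2 \<le> D" "degree s3 \<le> D" "D + N \<le> Suc L"
    and "x \<in> poly_below (Suc L)"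
  shows "of_nat (CARD('a) ^ Suc L) * weighted_solutions N s1 s2 s3 f1 f2 f3 x
    = (\<Sum>h\<in>poly_below (Suc L).
        fourier N L f1 s1 h * fourier N L f2 s2 h * fourier N L f3 s3 h * poly_char L h (- x))"
proof -
  let ?P = "poly_below N :: 'a poly set"
  have "fourier N L f1 s1 h * fourier N L f2 s2 h * fourier N L f3 s3 h * poly_char L h (- x)
      = (\<Sum>(a, b, c)\<in>?P \<times> ?P \<times> ?P.
          f1 a * f2 b * f3 c * poly_char L h (s1 * a + s2 * b + s3 * c + - x))" for h
  proof -
    have "fourier N L f1 s1 h * fourier N L f2 s2 h * fourier N L f3 s3 h
        = fourier N L f1 s1 h * (fourier N L f2 s2 h * fourier N L f3 s3 h)"
      by (simp only: mult.assoc)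
    also have "\<dots> = (\<Sum>(a, b, c)\<in>?P \<times> ?P \<times> ?P. (f1 a * poly_char L h (s1 * a)) *
        ((f2 b * poly_char L h (s2 * b)) * (f3 c * poly_char L h (s3 * c))))"
      unfolding fourier_def sum_product sum.cartesian_product by (simp add: case_prod_unfold)
    finally show ?thesis
      by (simp only: poly_char_add_right sum_distrib_right) (simp add: case_prod_unfold mult_ac)
  qed
  then have "(\<Sum>h\<in>poly_below (Suc L).
        fourier N L f1 s1 h * fourier N L f2 s2 h * fourier N L f3 s3 h * poly_char L h (- x))
      = (\<Sum>h\<in>poly_below (Suc L). \<Sum>(a, b, c)\<in>?P \<times> ?P \<times> ?P.
          f1 a * f2 b * f3 c * poly_char L h (s1 * a + s2 * b + s3 * c + - x))"
    by simp
  also have "\<dots> = (\<Sum>(a, b, c)\<in>?P \<times> ?P \<times> ?P. \<Sum>h\<in>poly_below (Suc L).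
          f1 a * f2 b * f3 c * poly_char L h (s1 * a + s2 * b + s3 * c + - x))"
    by (subst sum.swap) (simp add: case_prod_unfold)
  also have "\<dots> = (\<Sum>(a, b, c)\<in>?P \<times> ?P \<times> ?P. of_nat (CARD('a) ^ Suc L) *
      (if s1 * a + s2 * b + s3 * c = x then f1 a * f2 b * f3 c else 0))"
  proof (intro sum.cong refl)
    fix z assume z: "z \<in> ?P \<times> ?P \<times> ?P"
    obtain a b c where abc: "z = (a, b, c)"
      by (cases z)
    have "s1 * a + s2 * b + s3 * c + - x \<in> poly_below (Suc L)"
      using assms z by (auto simp: abc intro!: poly_below_add poly_below_diff intro: poly_below_mult)
    then have "(\<Sum>h\<in>poly_below (Suc L). poly_char L h (s1 * a + s2 * b + s3 * c + - x))
        = (if s1 * a + s2 * b + s3 * c = x then of_nat (CARD('a) ^ Suc L) else 0)"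
      by (subst sum_poly_char) auto
    then show "(case z of (a, b, c) \<Rightarrow> \<Sum>h\<in>poly_below (Suc L).
          f1 a * f2 b * f3 c * poly_char L h (s1 * a + s2 * b + s3 * c + - x))
        = (case z of (a, b, c) \<Rightarrow> of_nat (CARD('a) ^ Suc L) *
      (if s1 * a + s2 * b + s3 * c = x then f1 a * f2 b * f3 c else 0))"
      by (simp only: abc prod.case sum_distrib_left[symmetric]) simp
  qed
  finally show ?thesis
    by (simp add: weighted_solutions_def sum_distrib_left case_prod_unfold)
qed

text \<open>Since \<open>s \<noteq> 0\<close>, the map a -> s a is injective and only the diagonal
  survives orthogonality.\<close>

lemma plancherel:
  fixes s :: "'a::{field,finite} poly"
  assumes "degree s \<le> D" "D + N \<le> Suc L" "s \<noteq> 0"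
  shows "(\<Sum>h\<in>poly_below (Suc L). (norm (fourier N L f s h))\<^sup>2)
    = of_nat (CARD('a) ^ Suc L) * (\<Sum>a\<in>poly_below N. (norm (f a))\<^sup>2)"
proof -
  let ?P = "poly_below N :: 'a poly set"
  have "complex_of_real ((norm (fourier N L f s h))\<^sup>2)
      = (\<Sum>(a, b)\<in>?P \<times> ?P. f a * cnj (f b) * poly_char L h (s * a + - (s * b)))" for h
  proof -
    have "complex_of_real ((norm (fourier N L f s h))\<^sup>2) = fourier N L f s h * cnj (fourier N L f s h)"
      by (rule complex_norm_square)
    also have "\<dots> = (\<Sum>(a, b)\<in>?P \<times> ?P. (f a * poly_char L h (s * a)) *
        cnj (f b * poly_char L h (s * b)))"
      unfolding fourier_def cnj_sum sum_product sum.cartesian_product by simp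
    finally show ?thesis
      by (simp only: poly_char_add_right poly_char_minus) (simp add: case_prod_unfold mult_ac)
  qed
  then have "complex_of_real (\<Sum>h\<in>poly_below (Suc L). (norm (fourier N L f s h))\<^sup>2)
      = (\<Sum>h\<in>poly_below (Suc L). \<Sum>(a, b)\<in>?P \<times> ?P.
          f a * cnj (f b) * poly_char L h (s * a + - (s * b)))"
    by (simp only: of_real_sum)
  also have "\<dots> = (\<Sum>(a, b)\<in>?P \<times> ?P. \<Sum>h\<in>poly_below (Suc L).
          f a * cnj (f b) * poly_char L h (s * a + - (s * b)))"
    by (subst sum.swap) (simp add: case_prod_unfold)
  also have "\<dots> = (\<Sum>(a, b)\<in>?P \<times> ?P.
      if a = b then of_nat (CARD('a) ^ Suc L) * (f a * cnj (f b)) else 0)"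
  proof (intro sum.cong refl)
    fix z assume z: "z \<in> ?P \<times> ?P"
    obtain a b where ab: "z = (a, b)"
      by (cases z)
    have "s * a + - (s * b) \<in> poly_below (Suc L)"
      using assms z by (auto simp: ab intro!: poly_below_diff intro: poly_below_mult)
    then have "(\<Sum>h\<in>poly_below (Suc L). poly_char L h (s * a + - (s * b)))
        = (if a = b then of_nat (CARD('a) ^ Suc L) else 0)"
      using assms by (subst sum_poly_char) auto
    then show "(case z of (a, b) \<Rightarrow> \<Sum>h\<in>poly_below (Suc L).
          f a * cnj (f b) * poly_char L h (s * a + - (s * b)))
        = (case z of (a, b) \<Rightarrow> if a = b then of_nat (CARD('a) ^ Suc L) * (f a * cnj (f b)) else 0)"
      by (simp only: ab prod.case sum_distrib_left[symmetric]) simp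
  qed
  also have "\<dots> = (\<Sum>a\<in>?P. of_nat (CARD('a) ^ Suc L) * (f a * cnj (f a)))"
    by (simp flip: sum.cartesian_product)
  also have "\<dots> = complex_of_real (of_nat (CARD('a) ^ Suc L) * (\<Sum>a\<in>?P. (norm (f a))\<^sup>2))"
    by (simp only: complex_norm_square[symmetric] of_real_mult of_real_sum sum_distrib_left
        of_real_of_nat_eq)
  finally show ?thesis
    by (simp only: of_real_eq_iff)
qed

lemma sum_norm_fourier_le:
  fixes s :: "'a::{field,finite} poly"
  assumes "degree s \<le> D" "D + N \<le> Suc L" "s \<noteq> 0" and f: "\<And>a. norm (f a) \<le> 1"
  shows "(\<Sum>h\<in>poly_below (Suc L). (norm (fourier N L f s h))\<^sup>2)
    \<le> real (CARD('a) ^ Suc L) * real (CARD('a) ^ N)"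
proof -
  have "(\<Sum>a\<in>(poly_below N :: 'a poly set). (norm (f a))\<^sup>2) \<le> (\<Sum>a\<in>(poly_below N :: 'a poly set). 1)"
    using f by (intro sum_mono) (simp add: power_le_one)
  then show ?thesis
    unfolding plancherel[OF assms(1-3)] by (simp add: card_poly_below mult_left_mono)
qed

text \<open>A supremum bound for one factor and Cauchy-Schwarz, as x y \<le> (x^2 + y^2) / 2, for
  the other two. The weight \<open>w\<close> stays with \<open>F1\<close>, so that it may vanish
  exactly where \<open>F1\<close> is large.\<close>

lemma norm_sum_triple_le:
  fixes F1 F2 F3 w :: "'b \<Rightarrow> complex"
  assumes F1: "\<And>h. h \<in> H \<Longrightarrow> norm (F1 h * w h) \<le> \<kappa>" and "\<kappa> \<ge> 0"
    and F2: "(\<Sum>h\<in>H. (norm (F2 h))\<^sup>2) \<le> Q" and F3: "(\<Sum>h\<in>H. (norm (F3 h))\<^sup>2) \<le> Q"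
  shows "norm (\<Sum>h\<in>H. F1 h * F2 h * F3 h * w h) \<le> \<kappa> * Q"
proof -
  have "norm (\<Sum>h\<in>H. F1 h * F2 h * F3 h * w h)
      \<le> (\<Sum>h\<in>H. \<kappa> * (((norm (F2 h))\<^sup>2 + (norm (F3 h))\<^sup>2) / 2))"
  proof (rule sum_norm_le)
    fix h assume "h \<in> H"
    have "norm (F1 h * F2 h * F3 h * w h) = norm (F1 h * w h) * (norm (F2 h) * norm (F3 h))"
      by (simp add: norm_mult)
    also have "\<dots> \<le> \<kappa> * (((norm (F2 h))\<^sup>2 + (norm (F3 h))\<^sup>2) / 2)"
      using F1[OF \<open>h \<in> H\<close>] sum_squares_bound[of "norm (F2 h)" "norm (F3 h)"] \<open>\<kappa> \<ge> 0\<close>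
      by (intro mult_mono) auto
    finally show "norm (F1 h * F2 h * F3 h * w h) \<le> \<kappa> * (((norm (F2 h))\<^sup>2 + (norm (F3 h))\<^sup>2) / 2)" .
  qed
  also have "\<dots> = \<kappa> * (((\<Sum>h\<in>H. (norm (F2 h))\<^sup>2) + (\<Sum>h\<in>H. (norm (F3 h))\<^sup>2)) / 2)"
    by (simp add: sum_distrib_left sum.distrib sum_divide_distrib add_divide_distrib distrib_left)
  also have "\<dots> \<le> \<kappa> * Q"
    using F2 F3 \<open>\<kappa> \<ge> 0\<close> by (intro mult_left_mono) auto
  finally show ?thesis .
qed

section \<open>Solution counts and the large spectrum\<close>

definition solutions :: "'a::comm_semiring_1 \<Rightarrow> 'a \<Rightarrow> 'a \<Rightarrow> 'a set \<Rightarrow> 'a \<Rightarrow> ('a \<times> 'a \<times> 'a) set"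
  where "solutions s1 s2 s3 A x = {(a, b, c). a \<in> A \<and> b \<in> A \<and> c \<in> A \<and> s1 * a + s2 * b + s3 * c = x}"

lemma finite_solutions: "finite A \<Longrightarrow> finite (solutions s1 s2 s3 A x)"
  by (rule finite_subset[of _ "A \<times> A \<times> A"]) (auto simp: solutions_def)

lemma weighted_solutions_indicator:
  fixes A :: "'a::{field,finite} poly set"
  assumes "A \<subseteq> poly_below N"
  shows "weighted_solutions N s1 s2 s3 (indicator A) (indicator A) (indicator A) x
    = of_nat (card (solutions s1 s2 s3 A x))"
proof -
  let ?P = "poly_below N :: 'a poly set"
  have "weighted_solutions N s1 s2 s3 (indicator A) (indicator A) (indicator A) x
      = (\<Sum>z\<in>?P \<times> ?P \<times> ?P. if z \<in> solutions s1 s2 s3 A x then 1 else 0)"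
    unfolding weighted_solutions_def
    by (intro sum.cong refl) (auto simp: solutions_def indicator_def split: if_splits)
  also have "\<dots> = of_nat (card ((?P \<times> ?P \<times> ?P) \<inter> {z. z \<in> solutions s1 s2 s3 A x}))"
    by (subst sum.If_cases) auto
  also have "(?P \<times> ?P \<times> ?P) \<inter> {z. z \<in> solutions s1 s2 s3 A x} = solutions s1 s2 s3 A x"
    using assms by (auto simp: solutions_def)
  finally show ?thesis .
qed

text \<open>Turns a frequency into a linear functional of the coefficients of \<open>x\<close>. In
  this form the data from boxes of different size can be compared.\<close>

lemma coeff_mult_poly_below:
  fixes x :: "'a::comm_ring_1 poly"
  assumes "x \<in> poly_below N" "N \<le> Suc L"
  shows "coeff (h * x) L = (\<Sum>j<N. coeff h (L - j) * coeff x j)"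
proof -
  have "coeff (h * x) L = (\<Sum>j\<le>L. coeff h (L - j) * coeff x j)"
    using coeff_mult[of x h L] by (simp add: mult.commute)
  also have "\<dots> = (\<Sum>j<N. coeff h (L - j) * coeff x j)"
    using assms by (intro sum.mono_neutral_right) (auto simp: poly_below_def)
  finally show ?thesis .
qed

text \<open>The functionals are the frequencies at which the Fourier transform of \<open>A\<close> is large; the
  remaining frequencies cannot change the number of solutions by much.\<close>

lemma exists_functionals_of_many_solutions:
  fixes s1 s2 s3 :: "'a::{field,finite} poly" and \<epsilon> :: real
  assumes s: "s1 \<noteq> 0" "s2 \<noteq> 0" "s3 \<noteq> 0" and "\<epsilon> > 0"
  shows "\<exists>k::nat. \<forall>N A. A \<subseteq> poly_below N \<longrightarrow>
    \<epsilon> * real CARD('a) ^ (2 * N) \<le> real (card (solutions s1 s2 s3 A 0)) \<longrightarrow>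
    (\<exists>c. \<forall>x\<in>poly_below N. (\<forall>i<k. (\<Sum>j<N. c i j * coeff x j) = 0) \<longrightarrow> solutions s1 s2 s3 A x \<noteq> {})"
proof -
  define q where "q = real CARD('a)"
  have q: "q > 0"
    by (simp add: q_def)
  define D where "D = degree s1 + degree s2 + degree s3"
  \<comment> \<open>The count at 0 is at least 3 \<eta> q^(2N), and passing from 0 to
    \<open>x\<close> changes it by at most 2 \<eta> q^(2N).\<close>
  define \<eta> where "\<eta> = \<epsilon> / 3"
  have \<eta>: "\<eta> > 0"
    using \<open>\<epsilon> > 0\<close> by (simp add: \<eta>_def)
  \<comment> \<open>Plancherel bounds (\<eta> q^N)^2 times the size of the large spectrum by q^(L+1)
    q^N; with L = N + D all dependence on N cancels.\<close>
  define k where "k = nat \<lceil>q ^ Suc D / \<eta>\<^sup>2\<rceil>"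
  show ?thesis
  proof (intro exI[of _ k] allI impI)
    fix N and A :: "'a poly set"
    assume A: "A \<subseteq> poly_below N"
      and many: "\<epsilon> * real CARD('a) ^ (2 * N) \<le> real (card (solutions s1 s2 s3 A 0))"
    define L where "L = N + D"
    have D: "degree s1 \<le> D" "degree s2 \<le> D" "degree s3 \<le> D" and L: "D + N \<le> Suc L"
      by (auto simp: D_def L_def)
    define F where "F s h = fourier N L (indicator A) s h" for s h
    have F_sum: "(\<Sum>h\<in>poly_below (Suc L). (norm (F s h))\<^sup>2) \<le> q ^ Suc L * q ^ N"
      if "degree s \<le> D" "s \<noteq> 0" for s
      using sum_norm_fourier_le[OF that(1) L that(2), of "indicator A"]
      by (simp add: F_def q_def indicator_def)
    \<comment> \<open>Only the transform belonging to \<open>s1\<close> is thresholded; the other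
      two enter through their square sums.\<close>
    define \<Gamma> where "\<Gamma> = {h \<in> poly_below (Suc L). norm (F s1 h) \<ge> \<eta> * q ^ N}"
    have fin: "finite \<Gamma>"
      by (simp add: \<Gamma>_def)
    have "real (card \<Gamma>) * (\<eta> * q ^ N)\<^sup>2 = (\<Sum>h\<in>\<Gamma>. (\<eta> * q ^ N)\<^sup>2)"
      by simp
    also have "\<dots> \<le> (\<Sum>h\<in>\<Gamma>. (norm (F s1 h))\<^sup>2)"
      using \<eta> q by (intro sum_mono power_mono) (auto simp: \<Gamma>_def)
    also have "\<dots> \<le> (\<Sum>h\<in>poly_below (Suc L). (norm (F s1 h))\<^sup>2)"
      by (intro sum_mono2) (auto simp: \<Gamma>_def)
    also have "\<dots> \<le> q ^ Suc L * q ^ N"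
      by (rule F_sum[OF D(1) s(1)])
    also have "\<dots> = (q ^ Suc D / \<eta>\<^sup>2) * (\<eta> * q ^ N)\<^sup>2"
      using \<eta> by (simp add: L_def power_mult_distrib field_simps power_add power2_eq_square)
    finally have "real (card \<Gamma>) \<le> q ^ Suc D / \<eta>\<^sup>2"
      by (rule mult_right_le_imp_le) (use \<eta> q in simp)
    then have card_\<Gamma>: "card \<Gamma> \<le> k"
      unfolding k_def by linarith
    obtain g where g: "bij_betw g {0..<card \<Gamma>} \<Gamma>"
      using ex_bij_betw_nat_finite[OF fin] by blast
    show "\<exists>c. \<forall>x\<in>poly_below N. (\<forall>i<k. (\<Sum>j<N. c i j * coeff x j) = 0) \<longrightarrow> solutions s1 s2 s3 A x \<noteq> {}"
    \<comment> \<open>For \<open>i\<close> from \<open>card \<Gamma>\<close> up to \<open>k\<close>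
      the value \<open>g i\<close> is arbitrary, which merely puts further conditions on
      \<open>x\<close>.\<close>
    proof (intro exI[of _ "\<lambda>i j. coeff (g i) (L - j)"] ballI impI)
      fix x assume x: "x \<in> poly_below N"
        and zero: "\<forall>i<k. (\<Sum>j<N. coeff (g i) (L - j) * coeff x j) = 0"
      have char_x: "poly_char L h (- x) = 1" if h: "h \<in> \<Gamma>" for h
      proof -
        have "h \<in> g ` {0..<card \<Gamma>}"
          using g h by (simp add: bij_betw_def)
        then obtain i where "i < card \<Gamma>" "g i = h"
          by auto
        then have "coeff (h * x) L = 0"
          using zero card_\<Gamma> by (subst coeff_mult_poly_below[OF x]) (auto simp: L_def)
        then show ?thesis
          by (simp add: poly_char_def)
      qed
      have xL: "x \<in> poly_below (Suc L)"
        using x poly_below_mono[of N "Suc L"] by (auto simp: L_def)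
      define R where "R x = complex_of_nat (card (solutions s1 s2 s3 A x))" for x
      have R: "of_nat (CARD('a) ^ Suc L) * R x
          = (\<Sum>h\<in>poly_below (Suc L). F s1 h * F s2 h * F s3 h * poly_char L h (- x))"
        if "x \<in> poly_below (Suc L)" for x
        unfolding R_def weighted_solutions_indicator[OF A, symmetric] F_def
        by (rule fourier_inversion[OF D L that])
      have "of_nat (CARD('a) ^ Suc L) * (R x - R 0)
          = (\<Sum>h\<in>poly_below (Suc L). F s1 h * F s2 h * F s3 h * (poly_char L h (- x) - 1))"
        unfolding right_diff_distrib R[OF xL] R[OF poly_below_0] sum_subtractf by simp
      also have "norm \<dots> \<le> (2 * \<eta> * q ^ N) * (q ^ Suc L * q ^ N)"
      proof (rule norm_sum_triple_le)
        fix h :: "'a poly" assume h: "h \<in> poly_below (Suc L)"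
        show "norm (F s1 h * (poly_char L h (- x) - 1)) \<le> 2 * \<eta> * q ^ N"
        proof (cases "h \<in> \<Gamma>")
          case True
          then show ?thesis
            using \<eta> q by (simp add: char_x)
        next
          case False
          then have "norm (F s1 h) \<le> \<eta> * q ^ N"
            using h by (simp add: \<Gamma>_def)
          moreover have "norm (poly_char L h (- x) - 1) \<le> 2"
            using norm_triangle_ineq4[of "poly_char L h (- x)" 1] by simp
          ultimately have "norm (F s1 h) * norm (poly_char L h (- x) - 1) \<le> (\<eta> * q ^ N) * 2"
            using \<eta> q by (intro mult_mono) auto
          then show ?thesis
            by (simp add: norm_mult mult_ac)
        qed
      qed (use \<eta> q F_sum D s in auto)
      finally have "q ^ Suc L * norm (R x - R 0) \<le> q ^ Suc L * (2 * \<eta> * q ^ (2 * N))"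
        by (simp add: norm_mult norm_power q_def mult_ac power_mult power2_eq_square power_mult_distrib)
      then have diff: "norm (R x - R 0) \<le> 2 * \<eta> * q ^ (2 * N)"
        using q by (simp add: mult_le_cancel_left)
      have "norm (R 0) \<ge> 3 * \<eta> * q ^ (2 * N)"
        using many by (simp add: R_def \<eta>_def q_def)
      moreover have "\<eta> * q ^ (2 * N) > 0"
        using \<eta> q by simp
      moreover have "norm (R x - R 0) \<ge> norm (R 0) - norm (R x)"
        using norm_triangle_ineq2[of "R 0" "R x"] by (simp add: norm_minus_commute)
      ultimately have "norm (R x) > 0"
        using diff by linarith
      then show "solutions s1 s2 s3 A x \<noteq> {}"
        by (auto simp: R_def)
    qed
  qed
qed

section \<open>Roth's theorem\<close>

text \<open>The polynomials \<open>u\<close> for which the character is trivial on \<open>u \<cdot> poly_below M\<close> are cut out by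
  \<open>M\<close> linear conditions, so that there is a nonzero one of degree at most \<open>M\<close>.\<close>

lemma exists_dilate_in_kernel:
  fixes g :: "'a::{field,finite} poly"
  assumes "M \<le> Suc L"
  shows "\<exists>u. u \<noteq> 0 \<and> degree u \<le> M \<and> (\<forall>x\<in>poly_below M. coeff (g * (u * x)) L = 0)"
proof -
  let ?\<Phi> = "\<lambda>u. restrict (\<lambda>j. coeff (g * u) (L - j)) {..<M}"
  have "card (?\<Phi> ` poly_below (Suc M)) \<le> card ({..<M} \<rightarrow>\<^sub>E (UNIV :: 'a set))"
    by (intro card_mono finite_PiE image_subsetI restrict_PiE_iff[THEN iffD2]) auto
  also have "\<dots> = CARD('a) ^ M"
    by (simp add: card_PiE)
  also have "\<dots> < card (poly_below (Suc M) :: 'a poly set)"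
    unfolding card_poly_below using card_field_ge_2[where 'a = 'a] by (intro power_strict_increasing) auto
  finally obtain v w where vw: "v \<in> poly_below (Suc M)" "w \<in> poly_below (Suc M)" "v \<noteq> w" "?\<Phi> v = ?\<Phi> w"
    using pigeonhole unfolding inj_on_def by blast
  have eq: "coeff (g * v) (L - j) = coeff (g * w) (L - j)" if "j < M" for j
    using fun_cong[OF vw(4), of j] that by simp
  have "v - w \<in> poly_below (Suc M)"
    using vw by (intro poly_below_diff)
  then have "degree (v - w) \<le> M"
    by (auto simp: poly_below_iff)
  moreover have "coeff (g * ((v - w) * x)) L = 0" if x: "x \<in> poly_below M" for x
  proof -
    have "coeff (g * (v - w)) (L - j) = 0" if "j < M" for j
      using eq[OF that] by (simp add: right_diff_distrib)
    then have "coeff (g * (v - w) * x) L = 0"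
      by (simp add: coeff_mult_poly_below[OF x assms])
    then show ?thesis
      by (simp only: mult.assoc)
  qed
  ultimately show ?thesis
    using vw(3) by (intro exI[of _ "v - w"]) auto
qed

section \<open>Density increment and its iteration\<close>

lemma sum_shift_poly_below:
  fixes y :: "'a::{field,finite} poly"
  assumes "y \<in> poly_below N"
  shows "(\<Sum>c\<in>poly_below N. F (c + y)) = (\<Sum>c\<in>poly_below N. F c)"
  by (rule sum.reindex_bij_witness[of _ "\<lambda>c. c - y" "\<lambda>c. c + y"])
    (use assms in \<open>auto intro: poly_below_add poly_below_diff\<close>)

text \<open>The character is constant on each copy \<open>c + u * x\<close>, so the sums
  \<open>G c\<close> of \<open>f\<close> over the copies satisfy: the total of |G c| is at least
  \<kappa> q^(M+N). Their own total is 0, hence the positive part carries half of this, which is the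
  source of \<open>\<kappa> / 2\<close>. As \<open>u\<close> has degree up to \<open>M\<close>,
  \<open>2 * M \<le> N\<close> keeps \<open>u * x\<close> in the box.\<close>

lemma density_increment:
  fixes g :: "'a::{field,finite} poly" and f :: "'a poly \<Rightarrow> real"
  assumes "2 * M \<le> N" "N \<le> Suc L" "\<kappa> > 0"
    and sum_f: "(\<Sum>a\<in>poly_below N. f a) = 0"
    and large: "\<kappa> * real CARD('a) ^ N \<le> norm (\<Sum>a\<in>poly_below N. complex_of_real (f a) * poly_char L g a)"
  shows "\<exists>u c. u \<noteq> 0 \<and> c \<in> poly_below N \<and> (\<forall>x\<in>poly_below M. u * x \<in> poly_below N) \<and>
    \<kappa> / 2 * real CARD('a) ^ M \<le> (\<Sum>x\<in>poly_below M. f (c + u * x))"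
proof -
  define q where "q = real CARD('a)"
  have q: "q > 0"
    by (simp add: q_def)
  obtain u where u: "u \<noteq> 0" "degree u \<le> M" "\<And>x. x \<in> poly_below M \<Longrightarrow> coeff (g * (u * x)) L = 0"
    using exists_dilate_in_kernel[of M L g] assms by auto
  have ux: "u * x \<in> poly_below N" if "x \<in> poly_below M" for x
    using poly_below_mult[OF u(2) that, of N] assms by simp
  define G where "G c = (\<Sum>x\<in>poly_below M. f (c + u * x))" for c
  let ?T = "\<Sum>a\<in>poly_below N. complex_of_real (f a) * poly_char L g a"
  have "of_real (q ^ M) * ?T = (\<Sum>x\<in>(poly_below M :: 'a poly set). ?T)"
    by (simp add: card_poly_below q_def)
  also have "\<dots> = (\<Sum>x\<in>poly_below M. \<Sum>c\<in>poly_below N.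
      complex_of_real (f (c + u * x)) * poly_char L g (c + u * x))"
    by (intro sum.cong refl sum_shift_poly_below[symmetric] ux)
  also have "\<dots> = (\<Sum>x\<in>poly_below M. \<Sum>c\<in>poly_below N.
      complex_of_real (f (c + u * x)) * poly_char L g c)"
  proof (intro sum.cong refl)
    fix x c :: "'a poly" assume "x \<in> poly_below M"
    then have "poly_char L g (u * x) = 1"
      using u(3) by (simp add: poly_char_def)
    then show "complex_of_real (f (c + u * x)) * poly_char L g (c + u * x)
        = complex_of_real (f (c + u * x)) * poly_char L g c"
      by (simp add: poly_char_add_right)
  qed
  also have "\<dots> = (\<Sum>c\<in>poly_below N. complex_of_real (G c) * poly_char L g c)"
    by (subst sum.swap) (simp add: G_def sum_distrib_right)
  finally have "norm (complex_of_real (q ^ M) * ?T)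
      = norm (\<Sum>c\<in>poly_below N. complex_of_real (G c) * poly_char L g c)"
    by (rule arg_cong)
  then have "q ^ M * norm ?T = norm (\<Sum>c\<in>poly_below N. complex_of_real (G c) * poly_char L g c)"
    using q by (simp only: norm_mult norm_of_real) simp
  also have "\<dots> \<le> (\<Sum>c\<in>poly_below N. \<bar>G c\<bar>)"
    by (rule sum_norm_le) (simp add: norm_mult)
  finally have abs_G: "q ^ M * norm ?T \<le> (\<Sum>c\<in>poly_below N. \<bar>G c\<bar>)" .
  have sum_G: "(\<Sum>c\<in>poly_below N. G c) = 0"
    unfolding G_def by (subst sum.swap) (simp add: sum_shift_poly_below[OF ux] sum_f)
  have "\<exists>c\<in>poly_below N. \<kappa> / 2 * q ^ M \<le> G c"
  proof (rule ccontr)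
    assume "\<not> ?thesis"
    then have small: "G c < \<kappa> / 2 * q ^ M" if "c \<in> poly_below N" for c
      using that by force
    have "\<kappa> * q ^ M > 0"
      using q \<open>\<kappa> > 0\<close> by simp
    \<comment> \<open>|G| + G is twice the positive part, so an upper bound on G alone controls
      it.\<close>
    have "(\<Sum>c\<in>poly_below N. \<bar>G c\<bar>) = (\<Sum>c\<in>poly_below N. \<bar>G c\<bar> + G c)"
      by (simp add: sum.distrib sum_G)
    also have "\<dots> < (\<Sum>c\<in>(poly_below N :: 'a poly set). \<kappa> * q ^ M)"
    proof (rule sum_strict_mono)
      fix c :: "'a poly" assume "c \<in> poly_below N"
      then show "\<bar>G c\<bar> + G c < \<kappa> * q ^ M"
        using small[of c] \<open>\<kappa> * q ^ M > 0\<close> by (auto simp: abs_if)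
    next
      show "poly_below N \<noteq> ({} :: 'a poly set)"
        using poly_below_0 by blast
    qed simp
    also have "\<dots> = q ^ M * (\<kappa> * q ^ N)"
      by (simp add: card_poly_below q_def)
    also have "\<dots> \<le> q ^ M * norm ?T"
      using large q by (intro mult_left_mono) (auto simp: q_def)
    finally show False
      using abs_G by simp
  qed
  then show ?thesis
    using u(1) ux unfolding G_def q_def by blast
qed

text \<open>When the coefficients are nonzero and sum to 0, \<open>a = b\<close> forces
  \<open>c = a\<close>; thus \<open>a \<noteq> b\<close> excludes exactly the constant triples. It
  also survives x -> c + u x with u \<noteq> 0.\<close>

definition has_nontrivial_solution :: "'a::comm_semiring_1 \<Rightarrow> 'a \<Rightarrow> 'a \<Rightarrow> 'a set \<Rightarrow> bool"
  where "has_nontrivial_solution s1 s2 s3 A \<longleftrightarrow> (\<exists>(a, b, c) \<in> solutions s1 s2 s3 A 0. a \<noteq> b)"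

text \<open>The triples (c + s2 y, c - s1 y, c) are solutions, and giving up \<open>D\<close> in the
  degree of y keeps them in the box. This is the main term of the count.\<close>

lemma card_solutions_poly_below:
  fixes s1 s2 s3 :: "'a::{field,finite} poly"
  assumes "s1 \<noteq> 0" "s1 + s2 + s3 = 0" "degree s1 \<le> D" "degree s2 \<le> D" "D \<le> N"
  shows "CARD('a) ^ (N + (N - D)) \<le> card (solutions s1 s2 s3 (poly_below N) 0)"
proof -
  let ?\<phi> = "\<lambda>(c, y). (c + s2 * y, c - s1 * y, c)"
  have "CARD('a) ^ (N + (N - D)) = card (poly_below N \<times> poly_below (N - D) :: ('a poly \<times> 'a poly) set)"
    by (simp add: card_cartesian_product card_poly_below power_add)
  also have "\<dots> = card (?\<phi> ` (poly_below N \<times> poly_below (N - D)))"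
    by (rule card_image[symmetric]) (use \<open>s1 \<noteq> 0\<close> in \<open>auto simp: inj_on_def\<close>)
  also have "\<dots> \<le> card (solutions s1 s2 s3 (poly_below N) 0)"
  proof (rule card_mono)
    show "?\<phi> ` (poly_below N \<times> poly_below (N - D)) \<subseteq> solutions s1 s2 s3 (poly_below N) 0"
    proof clarify
      fix c y :: "'a poly" assume c: "c \<in> poly_below N" and y: "y \<in> poly_below (N - D)"
      have "s1 * (c + s2 * y) + s2 * (c - s1 * y) + s3 * c = (s1 + s2 + s3) * c"
        by (simp add: algebra_simps)
      moreover have "s1 * y \<in> poly_below N" "s2 * y \<in> poly_below N"
        using assms(3-) y by (auto intro: poly_below_mult)
      ultimately show "(c + s2 * y, c - s1 * y, c) \<in> solutions s1 s2 s3 (poly_below N) 0"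
        using c assms(2) by (simp add: solutions_def poly_below_add poly_below_diff)
    qed
  qed (simp add: finite_solutions)
  finally show ?thesis .
qed

lemma card_solutions_le_of_trivial:
  fixes s1 s2 s3 :: "'a::idom"
  assumes "s3 \<noteq> 0" "s1 + s2 + s3 = 0" "finite A" "\<not> has_nontrivial_solution s1 s2 s3 A"
  shows "card (solutions s1 s2 s3 A 0) \<le> card A"
proof -
  have "solutions s1 s2 s3 A 0 \<subseteq> (\<lambda>a. (a, a, a)) ` A"
  proof clarify
    fix a b c assume abc: "(a, b, c) \<in> solutions s1 s2 s3 A 0"
    then have "a = b"
      using assms(4) by (auto simp: has_nontrivial_solution_def)
    moreover have "s1 + s2 = - s3"
      using assms(2) by (simp add: eq_neg_iff_add_eq_0)
    ultimately have "s3 * c = s3 * a"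
      using abc by (simp add: solutions_def flip: distrib_right)
    then have "c = a"
      using \<open>s3 \<noteq> 0\<close> by simp
    then show "(a, b, c) \<in> (\<lambda>a. (a, a, a)) ` A"
      using abc \<open>a = b\<close> by (auto simp: solutions_def)
  qed
  then have "card (solutions s1 s2 s3 A 0) \<le> card ((\<lambda>a. (a, a, a)) ` A)"
    using assms(3) by (intro card_mono) auto
  also have "\<dots> \<le> card A"
    using assms(3) by (rule card_image_le)
  finally show ?thesis .
qed

text \<open>If every coefficient of the balanced function were small, the transform of
  \<open>A\<close> could be replaced by \<alpha> times that of the box in all three factors. Then
  \<open>A\<close> would have at least half of \<delta>^3 q^(2N-D) solutions, more than the q^N that
  constant triples can supply. No degree bound is put on \<open>g\<close>, because it arises as
  \<open>h * s\<close>.\<close>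

lemma exists_large_fourier_coefficient:
  fixes s1 s2 s3 :: "'a::{field,finite} poly" and \<alpha> \<delta> :: real
  assumes s: "s1 \<noteq> 0" "s2 \<noteq> 0" "s3 \<noteq> 0" "s1 + s2 + s3 = 0"
    and D: "degree s1 \<le> D" "degree s2 \<le> D" "degree s3 \<le> D" and "D \<le> N"
    and A: "A \<subseteq> poly_below N" and card_A: "real (card A) = \<alpha> * real CARD('a) ^ N"
    and \<delta>: "0 < \<delta>" "\<delta> \<le> \<alpha>" and N: "2 * real CARD('a) ^ D < \<delta> ^ 3 * real CARD('a) ^ N"
    and trivial: "\<not> has_nontrivial_solution s1 s2 s3 A"
  shows "\<exists>g. \<delta> ^ 3 / (6 * real CARD('a) ^ D) * real CARD('a) ^ N \<le>
    norm (\<Sum>a\<in>poly_below N. complex_of_real (indicator A a - \<alpha>) * poly_char (N + D) g a)"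
proof (rule ccontr)
  assume contr: "\<not> ?thesis"
  define q where "q = real CARD('a)"
  have q: "q > 0"
    by (simp add: q_def)
  define L where "L = N + D"
  have L: "D + N \<le> Suc L"
    by (simp add: L_def)
  \<comment> \<open>The three replacements cost 3 \<eta> q^(2N), half of the main term \<delta>^3
    q^(2N-D).\<close>
  define \<eta> where "\<eta> = \<delta> ^ 3 / (6 * q ^ D)"
  have \<eta>: "\<eta> \<ge> 0"
    using \<delta> q by (simp add: \<eta>_def)
  have fin: "finite A"
    using finite_subset[OF A] by simp
  have "real (card A) \<le> q ^ N"
    using card_mono[OF _ A] by (simp add: card_poly_below q_def flip: of_nat_power)
  then have \<alpha>: "0 \<le> \<alpha>" "\<alpha> \<le> 1"
    using \<delta> q by (auto simp: card_A simp flip: q_def)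
  define F where "F s h = fourier N L (indicator A) s h" for s h
  define E where "E s h = fourier N L (indicator (poly_below N)) s h" for s :: "'a poly" and h
  define E' where "E' s h = complex_of_real \<alpha> * E s h" for s h
  have E': "E' s h = fourier N L (\<lambda>a. complex_of_real \<alpha> * indicator (poly_below N) a) s h" for s h
    by (simp add: E'_def E_def fourier_def sum_distrib_left mult_ac)
  have diff: "norm (F s h - E' s h) \<le> \<eta> * q ^ N" for s h
  proof -
    have "F s h - E' s h = (\<Sum>a\<in>poly_below N. complex_of_real (indicator A a - \<alpha>) * poly_char L (h * s) a)"
      unfolding F_def E' fourier_def sum_subtractf[symmetric]
      by (intro sum.cong refl) (simp add: poly_char_def algebra_simps indicator_def)
    moreover have "\<not> \<eta> * q ^ N \<le>
        norm (\<Sum>a\<in>poly_below N. complex_of_real (indicator A a - \<alpha>) * poly_char L (h * s) a)"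
      using contr unfolding L_def \<eta>_def q_def by blast
    ultimately show ?thesis
      by simp
  qed
  define Q where "Q = q ^ Suc L * q ^ N"
  have F_sum: "(\<Sum>h\<in>poly_below (Suc L). (norm (F s h))\<^sup>2) \<le> Q"
    if "degree s \<le> D" "s \<noteq> 0" for s
    using sum_norm_fourier_le[OF that(1) L that(2), of "indicator A"]
    by (simp add: F_def Q_def q_def indicator_def)
  have E'_sum: "(\<Sum>h\<in>poly_below (Suc L). (norm (E' s h))\<^sup>2) \<le> Q"
    if "degree s \<le> D" "s \<noteq> 0" for s
    using sum_norm_fourier_le[OF that(1) L that(2), of "\<lambda>a. complex_of_real \<alpha> * indicator (poly_below N) a"] \<alpha>
    by (simp add: E' Q_def q_def indicator_def norm_mult)
  let ?H = "poly_below (Suc L) :: 'a poly set"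
  have Eq_A: "of_nat (CARD('a) ^ Suc L) * of_nat (card (solutions s1 s2 s3 A 0))
      = (\<Sum>h\<in>?H. F s1 h * F s2 h * F s3 h)"
    unfolding weighted_solutions_indicator[OF A, symmetric] F_def
    by (subst fourier_inversion[OF D L poly_below_0]) simp
  have Eq_P: "of_nat (CARD('a) ^ Suc L) * of_nat (card (solutions s1 s2 s3 (poly_below N) 0))
      = (\<Sum>h\<in>?H. E s1 h * E s2 h * E s3 h)"
    unfolding weighted_solutions_indicator[OF subset_refl, symmetric] E_def
    by (subst fourier_inversion[OF D L poly_below_0]) simp
  let ?SF = "\<Sum>h\<in>?H. F s1 h * F s2 h * F s3 h" and ?SE = "\<Sum>h\<in>?H. E' s1 h * E' s2 h * E' s3 h"
  \<comment> \<open>One factor is replaced at a time; each difference is bounded uniformly, the two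
    remaining factors in square sum.\<close>
  have "?SF - ?SE = (\<Sum>h\<in>?H. (F s1 h - E' s1 h) * F s2 h * F s3 h * 1)
      + (\<Sum>h\<in>?H. (F s2 h - E' s2 h) * E' s1 h * F s3 h * 1)
      + (\<Sum>h\<in>?H. (F s3 h - E' s3 h) * E' s1 h * E' s2 h * 1)"
    unfolding sum_subtractf[symmetric] sum.distrib[symmetric]
    by (intro sum.cong refl) (simp add: algebra_simps)
  also have "norm \<dots> \<le> \<eta> * q ^ N * Q + \<eta> * q ^ N * Q + \<eta> * q ^ N * Q"
    using diff F_sum E'_sum D s \<eta> q
    by (intro norm_triangle_le add_mono norm_sum_triple_le) auto
  finally have "norm (?SF - ?SE) \<le> 3 * \<eta> * q ^ N * Q"
    by (simp add: mult_ac)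
  then have "norm ?SE \<le> norm ?SF + 3 * \<eta> * q ^ N * Q"
    using norm_triangle_sub[of ?SE ?SF] by (simp add: norm_minus_commute)
  also have "norm ?SF
      = q ^ Suc L * real (card (solutions s1 s2 s3 A 0))"
    unfolding Eq_A[symmetric] by (simp add: norm_mult norm_power q_def)
  also have "?SE = complex_of_real (\<alpha> ^ 3) * (\<Sum>h\<in>?H. E s1 h * E s2 h * E s3 h)"
    by (simp add: E'_def sum_distrib_left power3_eq_cube mult_ac)
  also have "norm \<dots> = \<alpha> ^ 3 * (q ^ Suc L * real (card (solutions s1 s2 s3 (poly_below N) 0)))"
    unfolding Eq_P[symmetric] using \<alpha> by (simp add: norm_mult norm_power q_def)
  finally have "q ^ Suc L * (\<alpha> ^ 3 * real (card (solutions s1 s2 s3 (poly_below N) 0)))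
      \<le> q ^ Suc L * (real (card (solutions s1 s2 s3 A 0)) + 3 * \<eta> * q ^ N * q ^ N)"
    by (simp add: Q_def algebra_simps)
  then have main: "\<alpha> ^ 3 * real (card (solutions s1 s2 s3 (poly_below N) 0))
      \<le> real (card (solutions s1 s2 s3 A 0)) + 3 * \<eta> * q ^ N * q ^ N"
    using q by (simp only: mult_le_cancel_left_pos zero_less_power)
  have "\<delta> ^ 3 * (q ^ N * q ^ (N - D)) \<le> \<alpha> ^ 3 * real (card (solutions s1 s2 s3 (poly_below N) 0))"
    using card_solutions_poly_below[OF s(1,4) D(1,2) \<open>D \<le> N\<close>] \<delta>
    by (intro mult_mono power_mono) (auto simp: q_def power_add simp flip: of_nat_power of_nat_mult)
  also note main
  also have "real (card (solutions s1 s2 s3 A 0)) \<le> q ^ N"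
    using card_solutions_le_of_trivial[OF s(3,4) fin trivial] \<open>real (card A) \<le> q ^ N\<close> by linarith
  also have "3 * \<eta> * q ^ N * q ^ N = \<delta> ^ 3 * (q ^ N * q ^ (N - D)) / 2"
    using q \<open>D \<le> N\<close> by (simp add: \<eta>_def power_diff field_simps)
  finally have "\<delta> ^ 3 * q ^ (N - D) \<le> 2"
    using q by (simp add: field_simps)
  then have "\<delta> ^ 3 * q ^ N \<le> 2 * q ^ D"
    using q \<open>D \<le> N\<close> by (simp add: power_diff field_simps)
  then show False
    using N by (simp add: q_def)
qed

text \<open>A property of the density alone, which turns the increment strategy into an implication
  from a higher density to a lower one.\<close>

definition dense_solvable :: "'a::{field,finite} poly \<Rightarrow> 'a poly \<Rightarrow> 'a poly \<Rightarrow> real \<Rightarrow> bool"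
  where "dense_solvable s1 s2 s3 \<delta> \<longleftrightarrow> (\<exists>N0. \<forall>N\<ge>N0. \<forall>A\<subseteq>poly_below N.
    \<delta> * real CARD('a) ^ N \<le> real (card A) \<longrightarrow> has_nontrivial_solution s1 s2 s3 A)"

text \<open>A set without nontrivial solutions gains density on a copy of
  \<open>poly_below (N div 2)\<close>, and a solution inside the copy carries over because the
  equation is homogeneous and translation invariant. The gain is half the size of the large Fourier
  coefficient, hence 12 instead of 6.\<close>

lemma dense_solvable_step:
  fixes s1 s2 s3 :: "'a::{field,finite} poly"
  assumes s: "s1 \<noteq> 0" "s2 \<noteq> 0" "s3 \<noteq> 0" "s1 + s2 + s3 = 0"
    and D: "degree s1 \<le> D" "degree s2 \<le> D" "degree s3 \<le> D"
    and "\<delta> > 0" and step: "dense_solvable s1 s2 s3 (\<delta> + \<delta> ^ 3 / (12 * real CARD('a) ^ D))"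
  shows "dense_solvable s1 s2 s3 \<delta>"
proof -
  define q where "q = real CARD('a)"
  have q: "q \<ge> 2"
    using card_field_ge_2[where 'a = 'a] by (simp add: q_def)
  define \<eta> where "\<eta> = \<delta> ^ 3 / (6 * q ^ D)"
  have \<eta>: "\<eta> > 0"
    using \<open>\<delta> > 0\<close> q by (simp add: \<eta>_def)
  obtain N0 where N0: "\<And>N A. N \<ge> N0 \<Longrightarrow> A \<subseteq> poly_below N \<Longrightarrow>
      (\<delta> + \<eta> / 2) * q ^ N \<le> real (card A) \<Longrightarrow> has_nontrivial_solution s1 s2 s3 A"
    using step unfolding dense_solvable_def \<eta>_def q_def by auto
  obtain N1 where N1: "2 * q ^ D / \<delta> ^ 3 < q ^ N1"
    using real_arch_pow[of q] q by auto
  show ?thesis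
    unfolding dense_solvable_def
  \<comment> \<open>\<open>2 * N0\<close> serves the box of half the size, \<open>D\<close> the
    solution count in the full box, and \<open>N1\<close> makes the constant triples
    negligible.\<close>
  proof (intro exI[of _ "max (2 * N0) (max D N1)"] allI impI)
    fix N and A :: "'a poly set"
    assume N: "max (2 * N0) (max D N1) \<le> N" and A: "A \<subseteq> poly_below N"
      and card_A: "\<delta> * real CARD('a) ^ N \<le> real (card A)"
    define \<alpha> where "\<alpha> = real (card A) / q ^ N"
    have \<alpha>: "\<delta> \<le> \<alpha>" "real (card A) = \<alpha> * real CARD('a) ^ N"
      using card_A q by (auto simp: \<alpha>_def field_simps q_def)
    have "2 * q ^ D < \<delta> ^ 3 * q ^ N1"
      using N1 \<open>\<delta> > 0\<close> by (simp add: field_simps)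
    also have "\<dots> \<le> \<delta> ^ 3 * q ^ N"
      using N q \<open>\<delta> > 0\<close> by (intro mult_left_mono power_increasing) auto
    finally have big: "2 * real CARD('a) ^ D < \<delta> ^ 3 * real CARD('a) ^ N"
      by (simp add: q_def)
    show "has_nontrivial_solution s1 s2 s3 A"
    proof (rule ccontr)
      assume "\<not> has_nontrivial_solution s1 s2 s3 A"
      then obtain g where g: "\<eta> * real CARD('a) ^ N \<le>
          norm (\<Sum>a\<in>poly_below N. complex_of_real (indicator A a - \<alpha>) * poly_char (N + D) g a)"
        using exists_large_fourier_coefficient[OF s D _ A \<alpha>(2) \<open>\<delta> > 0\<close> \<alpha>(1) big] N
        by (auto simp: \<eta>_def q_def)
      have indicator_sum: "(\<Sum>a\<in>poly_below K. indicator B (p a) - \<alpha>)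
          = real (card {x \<in> poly_below K. p x \<in> B}) - \<alpha> * q ^ K" 
        for B and p :: "'a poly \<Rightarrow> 'a poly" and K
      proof -
        have "(\<Sum>a\<in>poly_below K. indicator B (p a)) = (\<Sum>a\<in>{x \<in> poly_below K. p x \<in> B}. 1 :: real)"
          by (rule sum.mono_neutral_cong_right) auto
        then show ?thesis
          by (simp add: sum_subtractf card_poly_below q_def)
      qed
      have "{x \<in> poly_below N. x \<in> A} = A"
        using A by auto
      then have "(\<Sum>a\<in>poly_below N. indicator A a - \<alpha>) = 0"
        using indicator_sum[of A "\<lambda>x. x" N] \<alpha>(2) by (simp add: q_def)
      then obtain u c where u: "u \<noteq> 0" "c \<in> poly_below N"
        and ux: "\<And>x. x \<in> poly_below (N div 2) \<Longrightarrow> u * x \<in> poly_below N"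
        and inc: "\<eta> / 2 * q ^ (N div 2) \<le> (\<Sum>x\<in>poly_below (N div 2). indicator A (c + u * x) - \<alpha>)"
        using density_increment[of "N div 2" N "N + D" \<eta> "\<lambda>a. indicator A a - \<alpha>" g] g \<eta>
        by (auto simp: q_def)
      define B where "B = {x \<in> poly_below (N div 2). c + u * x \<in> A}"
      have "(\<alpha> + \<eta> / 2) * q ^ (N div 2) \<le> real (card B)"
        using inc unfolding indicator_sum B_def by (simp add: distrib_right)
      moreover have "(\<delta> + \<eta> / 2) * q ^ (N div 2) \<le> (\<alpha> + \<eta> / 2) * q ^ (N div 2)"
        using \<alpha>(1) q by (intro mult_right_mono) auto
      ultimately have "has_nontrivial_solution s1 s2 s3 B"
        using N by (intro N0[of "N div 2"]) (auto simp: B_def)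
      then obtain x y z where xyz: "(x, y, z) \<in> solutions s1 s2 s3 B 0" "x \<noteq> y"
        by (auto simp: has_nontrivial_solution_def)
      have "s1 * (c + u * x) + s2 * (c + u * y) + s3 * (c + u * z)
          = (s1 + s2 + s3) * c + u * (s1 * x + s2 * y + s3 * z)"
        by (simp add: algebra_simps)
      then have "(c + u * x, c + u * y, c + u * z) \<in> solutions s1 s2 s3 A 0"
        using xyz s(4) by (simp add: solutions_def B_def)
      then show False
        using xyz(2) u(1) \<open>\<not> has_nontrivial_solution s1 s2 s3 A\<close>
        by (force simp: has_nontrivial_solution_def)
    qed
  qed
qed

text \<open>Any density \<epsilon> \<ge> \<delta> gains at least \<open>\<eta> \<delta>\<close>, so
  boundedly many increments lead above 1, where the claim is vacuous; \<open>n\<close> bounds the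
  increments still needed.\<close>

lemma roth_dense_solvable:
  fixes s1 s2 s3 :: "'a::{field,finite} poly"
  assumes s: "s1 \<noteq> 0" "s2 \<noteq> 0" "s3 \<noteq> 0" "s1 + s2 + s3 = 0" and "\<delta> > 0"
  shows "dense_solvable s1 s2 s3 \<delta>"
proof -
  define D where "D = degree s1 + degree s2 + degree s3"
  define \<eta> where "\<eta> \<epsilon> = \<epsilon> ^ 3 / (12 * real CARD('a) ^ D)" for \<epsilon> :: real
  have "\<eta> \<delta> > 0"
    using \<open>\<delta> > 0\<close> by (simp add: \<eta>_def)
  have "\<forall>\<epsilon>\<ge>\<delta>. \<epsilon> + real n * \<eta> \<delta> > 1 \<longrightarrow> dense_solvable s1 s2 s3 \<epsilon>" for n
  proof (induction n)
    case 0
    have False if "\<epsilon> > 1" "A \<subseteq> poly_below N" "\<epsilon> * real CARD('a) ^ N \<le> real (card A)"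
      for \<epsilon> :: real and N and A :: "'a poly set"
    proof -
      have "real (card A) \<le> 1 * real CARD('a) ^ N"
        using card_mono[OF _ that(2)] by (simp add: card_poly_below flip: of_nat_power)
      also have "\<dots> < \<epsilon> * real CARD('a) ^ N"
        using that(1) by (intro mult_strict_right_mono) auto
      finally show False
        using that(3) by simp
    qed
    then show ?case
      by (force simp: dense_solvable_def)
  next
    case (Suc n)
    show ?case
    proof (intro allI impI)
      fix \<epsilon> assume \<epsilon>: "\<delta> \<le> \<epsilon>" "1 < \<epsilon> + real (Suc n) * \<eta> \<delta>"
      have "\<eta> \<delta> \<le> \<eta> \<epsilon>"
        unfolding \<eta>_def using \<epsilon> \<open>\<delta> > 0\<close> by (intro divide_right_mono power_mono) auto
      then have "\<delta> \<le> \<epsilon> + \<eta> \<epsilon>" "1 < \<epsilon> + \<eta> \<epsilon> + real n * \<eta> \<delta>"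
        using \<epsilon> \<open>\<eta> \<delta> > 0\<close> by (simp_all add: distrib_right)
      then have "dense_solvable s1 s2 s3 (\<epsilon> + \<eta> \<epsilon>)"
        using Suc by blast
      then show "dense_solvable s1 s2 s3 \<epsilon>"
        unfolding \<eta>_def by (rule dense_solvable_step[OF s, rotated 4]) (use \<epsilon> \<open>\<delta> > 0\<close> in \<open>auto simp: D_def\<close>)
    qed
  qed
  moreover obtain n where "1 < real n * \<eta> \<delta>"
    using reals_Archimedean3[OF \<open>\<eta> \<delta> > 0\<close>] by blast
  moreover have "1 < \<delta> + real n * \<eta> \<delta>" if "1 < real n * \<eta> \<delta>" for n
    using that \<open>\<delta> > 0\<close> by simp
  ultimately show ?thesis
    by blast
qed

text \<open>Varnavides' averaging over the copies \<open>c + u \<cdot> poly_below M\<close> of a fixed box.\<close>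

lemma many_solutions_of_dense:
  fixes s1 s2 s3 :: "'a::{field,finite} poly"
  assumes s: "s1 \<noteq> 0" "s2 \<noteq> 0" "s3 \<noteq> 0" "s1 + s2 + s3 = 0" and "\<delta> > 0"
  shows "\<exists>\<epsilon>>0. \<exists>N0. \<forall>N\<ge>N0. \<forall>A\<subseteq>poly_below N. \<delta> * real CARD('a) ^ N \<le> real (card A) \<longrightarrow>
    \<epsilon> * real CARD('a) ^ (2 * N) \<le> real (card (solutions s1 s2 s3 A 0))"
proof -
  define q where "q = real CARD('a)"
  have q: "q \<ge> 2"
    using card_field_ge_2[where 'a = 'a] by (simp add: q_def)
  have "dense_solvable s1 s2 s3 (\<delta> / 2)"
    using \<open>\<delta> > 0\<close> by (intro roth_dense_solvable s) simp
  then obtain M where M: "\<And>A. A \<subseteq> poly_below M \<Longrightarrow> \<delta> / 2 * q ^ M \<le> real (card A) \<Longrightarrow>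
      has_nontrivial_solution s1 s2 s3 A"
    unfolding dense_solvable_def q_def by blast
  \<comment> \<open>At least (\<delta>/4) q^(2N-M) good copies, and each solution comes from at most
    q^(2M) of them.\<close>
  define \<epsilon> where "\<epsilon> = \<delta> / (4 * q ^ (3 * M))"
  have "\<epsilon> > 0"
    using \<open>\<delta> > 0\<close> q by (simp add: \<epsilon>_def)
  moreover have "\<epsilon> * real CARD('a) ^ (2 * N) \<le> real (card (solutions s1 s2 s3 A 0))"
    if N: "Suc M \<le> N" and A: "A \<subseteq> poly_below N" and card_A: "\<delta> * real CARD('a) ^ N \<le> real (card A)"
    for N and A :: "'a poly set"
  proof -
    let ?P = "poly_below N :: 'a poly set" and ?B = "poly_below M :: 'a poly set"
    define U where "U = poly_below (N - M) - {0 :: 'a poly}"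
    define A' where "A' c u = {x \<in> ?B. c + u * x \<in> A}" for c u
    have fin_A': "finite (A' c u)" for c u
      by (simp add: A'_def)
    define good where "good u = {c \<in> ?P. \<delta> / 2 * q ^ M \<le> real (card (A' c u))}" for u
    have fin_A: "finite A"
      using finite_subset[OF A] by simp
    have card_le: "real (card (A' c u)) \<le> q ^ M" for c u
    proof -
      have "card (A' c u) \<le> card ?B"
        by (intro card_mono) (auto simp: A'_def)
      then show ?thesis
        by (simp add: card_poly_below q_def flip: of_nat_power)
    qed
    have card_good: "\<delta> / 2 * q ^ N \<le> real (card (good u))" if u: "u \<in> U" for u
    proof -
      have "(\<Sum>c\<in>?P. real (card (A' c u))) = (\<Sum>c\<in>?P. \<Sum>x\<in>?B. indicator A (c + u * x))"
      proof (intro sum.cong refl)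
        fix c
        have "(\<Sum>x\<in>?B. indicator A (c + u * x)) = (\<Sum>x\<in>A' c u. 1 :: real)"
          by (rule sum.mono_neutral_cong_right) (auto simp: A'_def)
        then show "real (card (A' c u)) = (\<Sum>x\<in>?B. indicator A (c + u * x))"
          by simp
      qed
      also have "\<dots> = (\<Sum>x\<in>?B. \<Sum>c\<in>?P. indicator A (c + u * x))"
        by (rule sum.swap)
      also have "\<dots> = (\<Sum>x\<in>?B. \<Sum>c\<in>?P. indicator A c)"
      proof (rule sum.cong[OF refl], rule sum_shift_poly_below)
        fix x assume "x \<in> ?B"
        then show "u * x \<in> ?P"
          using u N poly_below_mult[of u "N - M" x M N] by (auto simp: U_def poly_below_iff)
      qed
      also have "(\<Sum>c\<in>?P. indicator A c) = real (card A)"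
      proof -
        have "(\<Sum>c\<in>?P. indicator A c) = (\<Sum>c\<in>A. 1 :: real)"
          using A by (intro sum.mono_neutral_cong_right) auto
        then show ?thesis
          by simp
      qed
      finally have "q ^ M * (\<delta> * q ^ N) \<le> (\<Sum>c\<in>?P. real (card (A' c u)))"
        using card_A q by (simp add: card_poly_below q_def mult_left_mono)
      \<comment> \<open>A shift that is not good contributes less than half the average, so good
        shifts have proportion at least \<open>\<delta> / 2\<close>.\<close>
      also have "\<dots> \<le> (\<Sum>c\<in>?P. \<delta> / 2 * q ^ M + (if c \<in> good u then q ^ M else 0))"
      proof (rule sum_mono)
        fix c assume "c \<in> ?P"
        have "0 \<le> \<delta> / 2 * q ^ M"
          using \<open>\<delta> > 0\<close> q by simp
        then show "real (card (A' c u)) \<le> \<delta> / 2 * q ^ M + (if c \<in> good u then q ^ M else 0)"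
          using \<open>c \<in> ?P\<close> card_le[of c u] by (auto simp: good_def)
      qed
      also have "\<dots> = q ^ N * (\<delta> / 2 * q ^ M) + q ^ M * real (card (good u))"
      proof -
        have "?P \<inter> {c. c \<in> good u} = good u"
          by (auto simp: good_def)
        then show ?thesis
          by (simp add: sum.distrib sum.If_cases card_poly_below q_def)
      qed
      finally have "q ^ M * (\<delta> / 2 * q ^ N) \<le> q ^ M * real (card (good u))"
        by (simp add: field_simps)
      then show ?thesis
        using q by (simp add: mult_le_cancel_left)
    qed
    define G where "G = (SIGMA u : U. good u)"
    have "real (card U) \<ge> q ^ (N - M) / 2"
    proof -
      have "q ^ 1 \<le> q ^ (N - M)"
        using N q by (intro power_increasing) auto
      then have "q ^ (N - M) \<ge> 2"
        using q by simp
      moreover have "real (card U) = q ^ (N - M) - 1"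
        unfolding U_def by (subst card_Diff_singleton) (simp_all add: card_poly_below q_def of_nat_diff Suc_leI)
      ultimately show ?thesis
        by simp
    qed
    then have "q ^ (N - M) / 2 * (\<delta> / 2 * q ^ N) \<le> real (card U) * (\<delta> / 2 * q ^ N)"
      using \<open>\<delta> > 0\<close> q by (intro mult_right_mono) auto
    also have "\<dots> = (\<Sum>u\<in>U. \<delta> / 2 * q ^ N)"
      by simp
    also have "\<dots> \<le> (\<Sum>u\<in>U. real (card (good u)))"
      by (intro sum_mono card_good)
    also have "\<dots> = real (card G)"
      unfolding G_def by (subst card_SigmaI) (auto simp: U_def good_def)
    finally have card_G: "q ^ (N - M) / 2 * (\<delta> / 2 * q ^ N) \<le> real (card G)" .
    have "\<exists>x y z. (x, y, z) \<in> solutions s1 s2 s3 (A' c u) 0 \<and> x \<noteq> y" if "(u, c) \<in> G" for u c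
      using M[of "A' c u"] that by (auto simp: G_def good_def A'_def has_nontrivial_solution_def)
    then obtain X Y Z where XYZ:
      "\<And>u c. (u, c) \<in> G \<Longrightarrow> (X u c, Y u c, Z u c) \<in> solutions s1 s2 s3 (A' c u) 0 \<and> X u c \<noteq> Y u c"
      by metis
    \<comment> \<open>The distinct positions x, y in the small box and the values c + u x, c + u y
      determine u and c.\<close>
    define \<theta> where "\<theta> = (\<lambda>(u, c). (X u c, Y u c, c + u * X u c, c + u * Y u c, c + u * Z u c))"
    have "inj_on \<theta> G"
    proof (rule inj_onI, clarify)
      fix u c u' c' assume G: "(u, c) \<in> G" "(u', c') \<in> G" and eq: "\<theta> (u, c) = \<theta> (u', c')"
      define x y where "x = X u c" and "y = Y u c"
      have "x \<noteq> y" "c + u * x = c' + u' * x" "c + u * y = c' + u' * y"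
        using XYZ[OF G(1)] eq by (auto simp: \<theta>_def x_def y_def)
      moreover have "(u - u') * (x - y) = (c + u * x - (c' + u' * x)) - (c + u * y - (c' + u' * y))"
        by (simp add: algebra_simps)
      ultimately show "u = u' \<and> c = c'"
        by simp
    qed
    moreover have "\<theta> ` G \<subseteq> ?B \<times> ?B \<times> solutions s1 s2 s3 A 0"
    proof (rule image_subsetI)
      fix z assume "z \<in> G"
      obtain u c where z: "z = (u, c)"
        by (cases z)
      from XYZ[of u c] \<open>z \<in> G\<close> have *: "X u c \<in> A' c u" "Y u c \<in> A' c u" "Z u c \<in> A' c u"
        "s1 * X u c + s2 * Y u c + s3 * Z u c = 0"
        by (auto simp: solutions_def z)
      have "s1 * (c + u * X u c) + s2 * (c + u * Y u c) + s3 * (c + u * Z u c)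
          = (s1 + s2 + s3) * c + u * (s1 * X u c + s2 * Y u c + s3 * Z u c)"
        by (simp add: algebra_simps)
      then show "\<theta> z \<in> ?B \<times> ?B \<times> solutions s1 s2 s3 A 0"
        using * s(4) by (simp add: z \<theta>_def solutions_def A'_def)
    qed
    ultimately have "card G \<le> card (?B \<times> ?B \<times> solutions s1 s2 s3 A 0)"
      by (rule card_inj_on_le) (simp add: finite_solutions fin_A)
    then have "real (card G) \<le> real (CARD('a) ^ M * (CARD('a) ^ M * card (solutions s1 s2 s3 A 0)))"
      by (simp only: card_cartesian_product card_poly_below of_nat_le_iff)
    then have "q ^ (N - M) / 2 * (\<delta> / 2 * q ^ N) \<le> q ^ M * q ^ M * real (card (solutions s1 s2 s3 A 0))"
      using card_G by (simp add: q_def)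
    moreover have "q ^ (N - M) / 2 * (\<delta> / 2 * q ^ N) = q ^ M * q ^ M * (\<epsilon> * q ^ (2 * N))"
    proof -
      obtain K where K: "N = M + K"
        using N le_Suc_ex by (metis Suc_leD)
      have "f / 2 * (\<delta> / 2 * (e * f)) = e * e * (\<delta> / (4 * (e * e * e)) * ((e * f) * (e * f)))"
        if "e \<noteq> 0" for e f :: real
        using that by (simp add: field_simps)
      from this[of "q ^ M" "q ^ K"] show ?thesis
        using q by (simp add: \<epsilon>_def K power_add power_mult power3_eq_cube power2_eq_square
            mult.commute[of 3] mult.commute[of 2])
    qed
    ultimately have "q ^ M * q ^ M * (\<epsilon> * q ^ (2 * N)) \<le> q ^ M * q ^ M * real (card (solutions s1 s2 s3 A 0))"
      by simp
    then show ?thesis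
      using q unfolding q_def[symmetric] by (simp add: mult_le_cancel_left)
  qed
  ultimately show ?thesis
    by blast
qed

section \<open>Monochromatic solutions\<close>

lemma exists_coeff_bound:
  fixes Z :: "'a::zero poly poly set"
  assumes "finite Z"
  shows "\<exists>M. \<forall>v\<in>Z. \<forall>j. coeff v j \<in> poly_below M"
  using assms
proof (induction Z rule: finite_induct)
  case empty
  then show ?case
    by simp
next
  case (insert v Z)
  then obtain M where M: "\<And>w j. w \<in> Z \<Longrightarrow> coeff w j \<in> poly_below M"
    by blast
  define K where "K = Suc (\<Sum>j\<le>degree v. degree (coeff v j))"
  have "coeff v j \<in> poly_below K" for j
  proof (cases "j \<le> degree v")
    case True
    then have "degree (coeff v j) \<le> (\<Sum>j\<le>degree v. degree (coeff v j))"
      by (intro member_le_sum) auto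
    then show ?thesis
      by (simp add: K_def poly_below_iff)
  next
    case False
    then show ?thesis
      by (simp add: coeff_eq_0)
  qed
  then have "coeff w j \<in> poly_below (max K M)" if "w \<in> insert v Z" for w j
    using that M[of w j] subsetD[OF poly_below_mono[of K "max K M"]]
      subsetD[OF poly_below_mono[of M "max K M"]] by auto
  then show ?case
    by blast
qed

definition poly_box :: "nat \<Rightarrow> nat \<Rightarrow> 'a::zero poly poly set"
  where "poly_box n M = {v. (\<forall>j\<ge>n. coeff v j = 0) \<and> (\<forall>j. coeff v j \<in> poly_below M)}"

lemma finite_poly_box: "finite (poly_box n M :: 'a::{zero,finite} poly poly set)"
proof (rule finite_imageD)
  have "(\<lambda>v. restrict (coeff v) {..<n}) ` poly_box n M \<subseteq> {..<n} \<rightarrow>\<^sub>E (poly_below M :: 'a poly set)"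
    by (intro image_subsetI restrict_PiE_iff[THEN iffD2]) (simp add: poly_box_def)
  moreover have "finite ({..<n} \<rightarrow>\<^sub>E (poly_below M :: 'a poly set))"
    by (intro finite_PiE) auto
  ultimately show "finite ((\<lambda>v. restrict (coeff v) {..<n}) ` (poly_box n M :: 'a poly poly set))"
    by (rule finite_subset)
next
  show "inj_on (\<lambda>v. restrict (coeff v) {..<n}) (poly_box n M :: 'a poly poly set)"
  proof (rule inj_onI)
    fix v w :: "'a poly poly"
    assume vw: "v \<in> poly_box n M" "w \<in> poly_box n M"
      and eq: "restrict (coeff v) {..<n} = restrict (coeff w) {..<n}"
    have "coeff v j = coeff w j" for j
      using fun_cong[OF eq, of j] vw by (cases "j < n") (auto simp: poly_box_def)
    then show "v = w"
      by (rule poly_eqI)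
  qed
qed

text \<open>The polynomials in the new variable play the role of vectors over \<open>F\<^sub>q[t]\<close>; the condition
  \<open>degree y < degree b\<close> is a convenient form of linear independence of \<open>b\<close> and \<open>y\<close>.\<close>

definition mono_config ::
  "'c set \<Rightarrow> ('c \<Rightarrow> 'a::field poly) \<Rightarrow> ('c \<Rightarrow> 'a poly) \<Rightarrow> 'a poly poly set \<Rightarrow> ('a poly poly \<Rightarrow> 'c) \<Rightarrow>
    'c \<Rightarrow> 'a poly poly \<Rightarrow> 'a poly poly \<Rightarrow> bool"
  where "mono_config I p s F \<chi> i b y \<longleftrightarrow> i \<in> I \<and> b \<in> F \<and> y \<in> F \<and> y \<noteq> 0 \<and> degree y < degree b \<and>
    b + smult (s i) y \<in> F \<and> smult (- p i) y \<in> F \<and>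
    \<chi> b = i \<and> \<chi> (b + smult (s i) y) = i \<and> \<chi> (smult (- p i) y) = i"

text \<open>Pigeonhole in the product set \<open>A\<^sup>Z\<close>: among more than \<open>r\<^bsup>|Z|\<^esup>\<close> translates of it, two overlap.\<close>

lemma exists_common_difference:
  fixes A B :: "'b::ab_group_add set" and \<tau> :: "'w \<Rightarrow> 'z \<Rightarrow> 'b"
  assumes "finite B" "A \<subseteq> B" "A \<noteq> {}" "finite Z" "finite W" "card B \<le> r * card A" "r ^ card Z < card W"
    and \<tau>: "\<And>w z a. w \<in> W \<Longrightarrow> z \<in> Z \<Longrightarrow> a \<in> B \<Longrightarrow> a + \<tau> w z \<in> B"
  shows "\<exists>w\<in>W. \<exists>w'\<in>W. w \<noteq> w' \<and> (\<forall>z\<in>Z. \<exists>a\<in>A. a + \<tau> w z - \<tau> w' z \<in> A)"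
proof -
  let ?T = "\<lambda>(w, f). restrict (\<lambda>z. f z + \<tau> w z) Z"
  have fin: "finite A"
    using assms finite_subset by blast
  have "card A > 0"
    using fin assms(3) by (simp add: card_gt_0_iff)
  have "card (?T ` (W \<times> (Z \<rightarrow>\<^sub>E A))) \<le> card (Z \<rightarrow>\<^sub>E B)"
    using assms(1,2,4) \<tau>
    by (intro card_mono finite_PiE image_subsetI) (auto simp: restrict_PiE_iff PiE_iff)
  also have "\<dots> \<le> (r * card A) ^ card Z"
    using assms(4,6) by (simp add: card_PiE power_mono)
  also have "\<dots> < card W * card A ^ card Z"
    using assms(7) \<open>card A > 0\<close> by (simp add: power_mult_distrib)
  also have "\<dots> = card (W \<times> (Z \<rightarrow>\<^sub>E A))"
    using assms(4) by (simp add: card_cartesian_product card_PiE)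
  finally have "\<not> inj_on ?T (W \<times> (Z \<rightarrow>\<^sub>E A))"
    by (rule pigeonhole)
  then obtain w f w' f' where w: "w \<in> W" "w' \<in> W" and f: "f \<in> Z \<rightarrow>\<^sub>E A" "f' \<in> Z \<rightarrow>\<^sub>E A"
    and ne: "(w, f) \<noteq> (w', f')" and T: "?T (w, f) = ?T (w', f')"
    unfolding inj_on_def by auto
  have eq: "f z + \<tau> w z = f' z + \<tau> w' z" if "z \<in> Z" for z
    using fun_cong[OF T, of z] that by simp
  have "w \<noteq> w'"
  proof
    assume "w = w'"
    then have "f = f'"
      using eq by (intro PiE_ext[OF f]) auto
    then show False
      using ne \<open>w = w'\<close> by simp
  qed
  moreover have "f z \<in> A" "f z + \<tau> w z - \<tau> w' z \<in> A" if "z \<in> Z" for z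
    using f eq[OF that] that by (auto simp: PiE_iff)
  ultimately show ?thesis
    using w by blast
qed

lemma exists_dense_colour_class:
  assumes "finite I" "finite B" "B \<noteq> {}" "\<And>v. v \<in> B \<Longrightarrow> \<kappa> v \<in> I"
  shows "\<exists>i\<in>I. card B \<le> card I * card {v \<in> B. \<kappa> v = i}"
proof (rule ccontr)
  assume "\<not> ?thesis"
  then have less: "card I * card {v \<in> B. \<kappa> v = i} < card B" if "i \<in> I" for i
    using that by auto
  have "I \<noteq> {}"
    using assms(3,4) by auto
  have "B = (\<Union>i\<in>I. {v \<in> B. \<kappa> v = i})"
    using assms(4) by auto
  then have "card B \<le> (\<Sum>i\<in>I. card {v \<in> B. \<kappa> v = i})"
    using card_UN_le[OF assms(1), of "\<lambda>i. {v \<in> B. \<kappa> v = i}"] by simp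
  then have "card I * card B \<le> (\<Sum>i\<in>I. card I * card {v \<in> B. \<kappa> v = i})"
    by (simp flip: sum_distrib_left)
  also have "\<dots> < (\<Sum>i\<in>I. card B)"
    using assms(1) \<open>I \<noteq> {}\<close> less by (rule sum_strict_mono)
  finally show False
    by simp
qed

lemma exists_mono_config:
  fixes p s :: "'c \<Rightarrow> 'a::{field,finite} poly"
  assumes "finite I" and "\<And>i. i \<in> I \<Longrightarrow> p i \<noteq> 0"
  shows "\<exists>F. finite F \<and> (\<forall>\<chi>. (\<forall>v\<in>F. v \<noteq> 0 \<longrightarrow> \<chi> v \<in> I) \<longrightarrow> (\<exists>i b y. mono_config I p s F \<chi> i b y))"
  using assms
proof (induction I rule: finite_psubset_induct)
  case (psubset I)
  have "\<exists>F. finite F \<and> (\<forall>\<chi>. (\<forall>v\<in>F. v \<noteq> 0 \<longrightarrow> \<chi> v \<in> I - {i}) \<longrightarrow>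
      (\<exists>j b y. mono_config (I - {i}) p s F \<chi> j b y))" if "i \<in> I" for i
    using that psubset.prems by (intro psubset.IH) auto
  then have "\<forall>i\<in>I. \<exists>F. finite F \<and> (\<forall>\<chi>. (\<forall>v\<in>F. v \<noteq> 0 \<longrightarrow> \<chi> v \<in> I - {i}) \<longrightarrow>
      (\<exists>j b y. mono_config (I - {i}) p s F \<chi> j b y))"
    by blast
  from bchoice[OF this] obtain F where F_all: "\<forall>i\<in>I. finite (F i) \<and>
      (\<forall>\<chi>. (\<forall>v\<in>F i. v \<noteq> 0 \<longrightarrow> \<chi> v \<in> I - {i}) \<longrightarrow> (\<exists>j b y. mono_config (I - {i}) p s (F i) \<chi> j b y))"
    ..
  have F: "finite (F i)" if "i \<in> I" for i
    using F_all that by blast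
  have F_config: "\<exists>j b y. mono_config (I - {i}) p s (F i) \<chi> j b y"
    if "i \<in> I" "\<And>v. v \<in> F i \<Longrightarrow> v \<noteq> 0 \<Longrightarrow> \<chi> v \<in> I - {i}" for i \<chi>
    using F_all that by blast
  define Z where "Z = (\<Union>i\<in>I. F i)"
  have fin_Z: "finite Z"
    using F psubset.hyps by (simp add: Z_def)
  define n where "n = Suc (\<Sum>z\<in>Z. degree z)"
  have deg_Z: "degree z < n" if "z \<in> Z" for z
    using member_le_sum[of z Z degree] that fin_Z by (simp add: n_def less_Suc_eq_le)
  \<comment> \<open>The number that the translates in the pigeonhole argument must exceed. Taking
    them from a whole box keeps the difference of two of them in \<open>W\<close>.\<close>
  define K where "K = card I ^ card Z"
  define W where "W = (poly_below (Suc K) :: 'a poly set)"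
  have fin_W: "finite W"
    by (simp add: W_def)
  have "K < 2 ^ Suc K"
    by (rule less_trans[OF lessI less_exp])
  also have "\<dots> \<le> CARD('a) ^ Suc K"
    using card_field_ge_2[where 'a = 'a] by (rule power_mono) simp
  also have "\<dots> = card W"
    unfolding W_def card_poly_below ..
  finally have card_W: "card I ^ card Z < card W"
    by (simp add: K_def)
  \<comment> \<open>The dense colour is not known yet, so the box \<open>B\<close> is made stable
    under the translations of all colours.\<close>
  have "finite ((\<lambda>(i, w, z). smult (s i * w) z) ` (I \<times> W \<times> Z))"
    using psubset.hyps fin_W fin_Z by simp
  from exists_coeff_bound[OF this] obtain M where
    M: "\<forall>v\<in>(\<lambda>(i, w, z). smult (s i * w) z) ` (I \<times> W \<times> Z). \<forall>j. coeff v j \<in> poly_below M"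
    ..
  define B where "B = (poly_box n M :: 'a poly poly set)"
  have fin_B: "finite B" and "0 \<in> B"
    by (simp_all add: B_def finite_poly_box) (simp add: poly_box_def)
  have B_add: "v + smult (s i * w) z \<in> B" if "v \<in> B" "i \<in> I" "w \<in> W" "z \<in> Z" for v i w z
  proof -
    have "coeff (smult (s i * w) z) j \<in> poly_below M" for j
      using bspec[OF M, of "smult (s i * w) z"] that(2-) by force
    moreover have "coeff (smult (s i * w) z) j = 0" if "j \<ge> n" for j
      using deg_Z[OF \<open>z \<in> Z\<close>] that by (simp add: coeff_eq_0)
    ultimately show ?thesis
      using \<open>v \<in> B\<close> unfolding B_def poly_box_def by (auto intro: poly_below_add)
  qed
  \<comment> \<open>A fresh coordinate: the vectors \<open>X + v\<close> have degree
    \<open>n\<close>, above all of \<open>Z\<close>, which yields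
    \<open>degree y < degree b\<close>.\<close>
  define X where "X = monom (1 :: 'a poly) n"
  have deg_X: "degree (X + v) = n" if "v \<in> B" for v
  proof -
    have "v \<in> poly_below n"
      using that by (simp add: B_def poly_box_def poly_below_def)
    then have "degree v < n"
      by (auto simp: poly_below_iff n_def)
    then show ?thesis
      unfolding X_def by (subst degree_add_eq_left) (simp_all add: degree_monom_eq)
  qed
  define G where "G = (+) X ` B \<union> (\<lambda>(w, z). smult w z) ` (W \<times> Z)
    \<union> (\<lambda>(i, w, z). smult (- p i * w) z) ` (I \<times> W \<times> Z)"
  have "finite G"
    using psubset.hyps fin_W fin_Z fin_B by (simp add: G_def)
  \<comment> \<open>Covers the empty set of colours too: \<open>G\<close> contains the nonzero
    vector \<open>X\<close>, for which no colour would be available.\<close>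
  moreover have "\<exists>i b y. mono_config I p s G \<chi> i b y" if \<chi>: "\<forall>v\<in>G. v \<noteq> 0 \<longrightarrow> \<chi> v \<in> I" for \<chi>
  proof -
    have X_I: "\<chi> (X + v) \<in> I" if "v \<in> B" for v
    proof -
      have "X + v \<noteq> 0"
        using deg_X[OF that] by (auto simp: n_def)
      then show ?thesis
        using \<chi> that by (auto simp: G_def)
    qed
    obtain i where i: "i \<in> I" "card B \<le> card I * card {v \<in> B. \<chi> (X + v) = i}"
      using exists_dense_colour_class[of I B "\<lambda>v. \<chi> (X + v)"] psubset.hyps fin_B \<open>0 \<in> B\<close> X_I by blast
    define A where "A = {v \<in> B. \<chi> (X + v) = i}"
    have "card B > 0"
      using fin_B \<open>0 \<in> B\<close> by (auto simp: card_gt_0_iff)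
    then have "A \<noteq> {}"
      using i(2) unfolding A_def[symmetric] by (auto simp del: card_gt_0_iff)
    then obtain w w' where w: "w \<in> W" "w' \<in> W" "w \<noteq> w'"
      "\<And>z. z \<in> Z \<Longrightarrow> \<exists>a\<in>A. a + smult (s i * w) z - smult (s i * w') z \<in> A"
      using exists_common_difference[of B A Z W "card I" "\<lambda>w z. smult (s i * w) z"]
        fin_B fin_Z fin_W card_W i B_add by (auto simp: A_def)
    define e where "e = w - w'"
    have e: "e \<noteq> 0" "e \<in> W"
      using w(1-3) by (auto simp: e_def W_def intro: poly_below_diff)
    have diff: "\<exists>a\<in>A. a + smult (s i) (smult e z) \<in> A" if z: "z \<in> Z" for z
    proof -
      obtain a where "a \<in> A" "a + smult (s i * w) z - smult (s i * w') z \<in> A"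
        using w(4)[OF z] by blast
      moreover have "a + smult (s i * w) z - smult (s i * w') z = a + smult (s i) (smult e z)"
        by (simp add: e_def smult_diff_left smult_diff_right)
      ultimately show ?thesis
        by auto
    qed
    have "p i \<noteq> 0"
      using psubset.prems i(1) .
    show ?thesis
    proof (cases "\<exists>z\<in>Z. z \<noteq> 0 \<and> \<chi> (smult (- p i * e) z) = i")
      case True
      then obtain z where z: "z \<in> Z" "z \<noteq> 0" "\<chi> (smult (- p i * e) z) = i"
        by blast
      obtain a where a: "a \<in> A" "a + smult (s i) (smult e z) \<in> A"
        using diff[OF z(1)] by blast
      have "mono_config I p s G \<chi> i (X + a) (smult e z)"
        unfolding mono_config_def
      proof (intro conjI)
        show "i \<in> I" by fact
        show "X + a \<in> G"
          using a by (auto simp: G_def A_def)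
        show "smult e z \<in> G"
          using z(1) e(2) by (force simp: G_def)
        show "smult e z \<noteq> 0"
          using z(2) e(1) by simp
        show "degree (smult e z) < degree (X + a)"
          using a(1) deg_X[of a] deg_Z[OF z(1)] e(1) by (simp add: A_def)
        show "X + a + smult (s i) (smult e z) \<in> G"
          using a(2) by (auto simp: G_def A_def add.assoc)
        show "smult (- p i) (smult e z) \<in> G"
          using i(1) z(1) e(2) by (force simp: G_def)
        show "\<chi> (X + a) = i" "\<chi> (X + a + smult (s i) (smult e z)) = i"
          using a by (simp_all add: A_def add.assoc)
        show "\<chi> (smult (- p i) (smult e z)) = i"
          using z(3) by simp
      qed
      then show ?thesis
        by blast
    next
      case False
      define d where "d = - p i * e"
      have d: "d \<noteq> 0"
        using e(1) \<open>p i \<noteq> 0\<close> by (simp add: d_def)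
      have G_I: "smult d v \<in> G" if "v \<in> F i" for v
        using that i(1) e(2) by (force simp: G_def d_def Z_def)
      define \<chi>' where "\<chi>' v = \<chi> (smult d v)" for v
      have "\<chi>' v \<in> I - {i}" if "v \<in> F i" "v \<noteq> 0" for v
      proof -
        have "v \<in> Z"
          using that i(1) by (auto simp: Z_def)
        then have "\<chi> (smult d v) \<noteq> i"
          using False that(2) by (auto simp: d_def)
        moreover have "smult d v \<noteq> 0"
          using that(2) d by simp
        ultimately show ?thesis
          using \<chi> G_I[OF that(1)] by (simp add: \<chi>'_def)
      qed
      then obtain j b y where jby: "mono_config (I - {i}) p s (F i) \<chi>' j b y"
        using F_config[OF i(1), of \<chi>'] by blast
      have "mono_config I p s G \<chi> j (smult d b) (smult d y)"
        unfolding mono_config_def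
      proof (intro conjI)
        have *: "smult d b + smult (s j) (smult d y) = smult d (b + smult (s j) y)"
          "smult (- p j) (smult d y) = smult d (smult (- p j) y)"
          by (simp_all add: smult_add_right mult.commute)
        show "smult d b + smult (s j) (smult d y) \<in> G" "smult (- p j) (smult d y) \<in> G"
          unfolding * using jby unfolding mono_config_def by (blast intro: G_I)+
        show "\<chi> (smult d b + smult (s j) (smult d y)) = j" "\<chi> (smult (- p j) (smult d y)) = j"
          unfolding * using jby unfolding mono_config_def \<chi>'_def by blast+
      qed (use jby d in \<open>auto simp: mono_config_def \<chi>'_def intro!: G_I\<close>)
      then show ?thesis
        by blast
    qed
  qed
  ultimately show ?case
    by blast
qed

section \<open>Specialising vectors to polynomials\<close>

text \<open>The linear map sending the j-th unit vector to \<open>u j\<close>; it sees every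
  coordinate of \<open>v\<close> once \<open>degree v < n\<close>.\<close>

definition lin_eval :: "nat \<Rightarrow> 'a::comm_ring_1 poly \<Rightarrow> (nat \<Rightarrow> 'a) \<Rightarrow> 'a"
  where "lin_eval n v u = (\<Sum>j<n. coeff v j * u j)"

lemma lin_eval_add: "lin_eval n (v + w) u = lin_eval n v u + lin_eval n w u"
  by (simp add: lin_eval_def distrib_right sum.distrib)

lemma lin_eval_smult: "lin_eval n (smult a v) u = a * lin_eval n v u"
  by (simp add: lin_eval_def sum_distrib_left mult.assoc)

lemma lin_eval_eqD:
  fixes v :: "'a::idom poly"
  assumes eq: "lin_eval n v u = lin_eval n v u'" and "k < n" "coeff v k \<noteq> 0"
    and other: "\<And>j. j < n \<Longrightarrow> j \<noteq> k \<Longrightarrow> coeff v j = 0 \<or> u j = u' j"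
  shows "u k = u' k"
proof -
  have "lin_eval n v u = coeff v k * u k + (\<Sum>j\<in>{..<n} - {k}. coeff v j * u j)" for u
    using \<open>k < n\<close> by (simp add: lin_eval_def sum.remove)
  moreover have "(\<Sum>j\<in>{..<n} - {k}. coeff v j * u j) = (\<Sum>j\<in>{..<n} - {k}. coeff v j * u' j)"
    using other by (intro sum.cong) auto
  ultimately show ?thesis
    using eq \<open>coeff v k \<noteq> 0\<close> by simp
qed

text \<open>Each point \<open>u\<close> of a large box specialises the vectors of the finite set \<open>F\<close>
  to polynomials and so yields a monochromatic solution; independence of \<open>b\<close> and \<open>y\<close> bounds
  how often a solution is obtained.\<close>

lemma many_solutions_of_colouring:
  fixes p s :: "'c \<Rightarrow> 'a::{field,finite} poly"
  assumes "finite I" and p: "\<And>i. i \<in> I \<Longrightarrow> p i \<noteq> 0"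
  shows "\<exists>\<epsilon>>0. \<exists>N0. \<forall>N\<ge>N0. \<forall>A. (\<forall>i\<in>I. A i \<subseteq> poly_below N) \<longrightarrow> poly_below N \<subseteq> (\<Union>i\<in>I. A i) \<longrightarrow>
    (\<exists>i\<in>I. \<epsilon> * real CARD('a) ^ (2 * N) \<le> real (card (solutions (p i) (- p i) (s i) (A i) 0)))"
proof -
  define q where "q = real CARD('a)"
  have q: "q > 0"
    by (simp add: q_def)
  obtain F where F: "finite F \<and>
      (\<forall>\<chi>. (\<forall>v\<in>F. v \<noteq> 0 \<longrightarrow> \<chi> v \<in> I) \<longrightarrow> (\<exists>i b y. mono_config I p s F \<chi> i b y))"
    using exists_mono_config[OF assms, where s = s] ..
  then have fin_F: "finite F" ..
  have config: "\<exists>i b y. mono_config I p s F \<chi> i b y" if "\<forall>v\<in>F. \<chi> v \<in> I" for \<chi>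
    using F that by simp
  obtain M where "\<forall>v\<in>F. \<forall>j. coeff v j \<in> poly_below M"
    using exists_coeff_bound[OF fin_F] ..
  then have M: "coeff v j \<in> poly_below M" if "v \<in> F" for v j
    using that by simp
  define n where "n = Suc (\<Sum>v\<in>F. degree v)"
  have deg_F: "degree v < n" if "v \<in> F" for v
    using member_le_sum[of v F degree] that fin_F by (simp add: n_def less_Suc_eq_le)
  \<comment> \<open>There are at most |I| |F|^2 configurations, and restricting points to degree
    below N - M loses q^(2M). \<open>Suc\<close> makes the final inequality strict.\<close>
  define \<epsilon> where "\<epsilon> = 1 / (real (Suc (card I * card F ^ 2)) * q ^ (2 * M))"
  have "\<epsilon> > 0"
    unfolding \<epsilon>_def using q by (intro divide_pos_pos mult_pos_pos zero_less_power of_nat_0_less_iff[THEN iffD2]) simp_all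
  moreover have "\<exists>i\<in>I. \<epsilon> * real CARD('a) ^ (2 * N) \<le> real (card (solutions (p i) (- p i) (s i) (A i) 0))"
    if N: "M \<le> N" and A: "\<And>i. i \<in> I \<Longrightarrow> A i \<subseteq> poly_below N" and cover: "poly_below N \<subseteq> (\<Union>i\<in>I. A i)"
    for N A
  proof (rule ccontr)
    assume "\<not> ?thesis"
    then have few: "real (card (solutions (p i) (- p i) (s i) (A i) 0)) \<le> \<epsilon> * q ^ (2 * N)" if "i \<in> I" for i
      using that by (force simp: q_def)
    define S where "S i = solutions (p i) (- p i) (s i) (A i) 0" for i
    have fin_S: "finite (S i)" if "i \<in> I" for i
      unfolding S_def using finite_subset[OF A[OF that]] by (simp add: finite_solutions)
    \<comment> \<open>Entries of vectors in \<open>F\<close> have degree below \<open>M\<close>, so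
      specialisations at these points stay in \<open>poly_below N\<close>.\<close>
    define P where "P = (poly_below (N - M) :: 'a poly set)"
    have fin_P: "finite P"
      by (simp add: P_def)
    define U where "U = {..<n} \<rightarrow>\<^sub>E P"
    have "lin_eval n v u \<in> poly_below N" if "v \<in> F" "u \<in> U" for v u
      unfolding lin_eval_def
    proof (rule poly_below_sum)
      fix j assume "j \<in> {..<n}"
      have "degree (coeff v j) \<le> M"
        using M[OF \<open>v \<in> F\<close>, of j] by (auto simp: poly_below_iff)
      moreover have "u j \<in> poly_below (N - M)"
        using \<open>u \<in> U\<close> \<open>j \<in> {..<n}\<close> by (auto simp: U_def P_def)
      ultimately show "coeff v j * u j \<in> poly_below N"
        using N by (intro poly_below_mult) auto
    qed
    then have colour: "\<exists>i. i \<in> I \<and> lin_eval n v u \<in> A i" if "u \<in> U" "v \<in> F" for u v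
      using cover that by blast
    \<comment> \<open>The classes may overlap, so one admissible colour is picked for each
      vector.\<close>
    define \<chi> where "\<chi> u v = (SOME i. i \<in> I \<and> lin_eval n v u \<in> A i)" for u v
    have \<chi>: "\<chi> u v \<in> I \<and> lin_eval n v u \<in> A (\<chi> u v)" if "u \<in> U" "v \<in> F" for u v
      unfolding \<chi>_def by (rule someI_ex[OF colour[OF that]])
    have "\<exists>i b y. mono_config I p s F (\<chi> u) i b y" if "u \<in> U" for u
      using \<chi>[OF that] by (intro config) blast
    then obtain ci cb cy where c: "\<And>u. u \<in> U \<Longrightarrow> mono_config I p s F (\<chi> u) (ci u) (cb u) (cy u)"
      by metis
    define K where "K = {(i, b, y) \<in> I \<times> F \<times> F. degree y < degree b \<and> y \<noteq> 0}"
    have K: "K \<subseteq> I \<times> F \<times> F" and fin: "finite (I \<times> F \<times> F)"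
      using \<open>finite I\<close> fin_F by (auto simp: K_def)
    have fin_K: "finite K"
      by (rule finite_subset[OF K fin])
    have "card K \<le> card (I \<times> F \<times> F)"
      by (rule card_mono[OF fin K])
    then have card_K: "card K \<le> card I * card F ^ 2"
      by (simp add: card_cartesian_product power2_eq_square)
    define T where "T = (\<lambda>(i, b :: 'a poly poly, y :: 'a poly poly). S i \<times> ({..<n} - {degree b, degree y} \<rightarrow>\<^sub>E P))"
    \<comment> \<open>The configuration, the solution it gives, and the n - 2 coordinates not
      recovered from that solution.\<close>
    define \<theta> where "\<theta> u = ((ci u, cb u, cy u),
        (lin_eval n (cb u + smult (s (ci u)) (cy u)) u, lin_eval n (cb u) u, lin_eval n (smult (- p (ci u)) (cy u)) u),
        restrict u ({..<n} - {degree (cb u), degree (cy u)}))" for u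
    have "inj_on \<theta> U"
    proof (rule inj_onI)
      fix u u' assume u: "u \<in> U" "u' \<in> U" and eq: "\<theta> u = \<theta> u'"
      define i b y where "i = ci u" and "b = cb u" and "y = cy u"
      have iby: "ci u' = i" "cb u' = b" "cy u' = y"
        using eq by (auto simp: \<theta>_def i_def b_def y_def)
      have conf: "i \<in> I" "b \<in> F" "y \<in> F" "y \<noteq> 0" "degree y < degree b"
        using c[OF u(1)] by (auto simp: mono_config_def i_def b_def y_def)
      have eq_b: "lin_eval n b u = lin_eval n b u'"
        and "lin_eval n (smult (- p i) y) u = lin_eval n (smult (- p i) y) u'"
        and eq_r: "restrict u ({..<n} - {degree b, degree y}) = restrict u' ({..<n} - {degree b, degree y})"
        using eq iby by (auto simp: \<theta>_def i_def[symmetric] b_def[symmetric] y_def[symmetric])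
      then have eq_y: "lin_eval n y u = lin_eval n y u'"
        using p[OF conf(1)] unfolding lin_eval_smult by simp
      have other: "u j = u' j" if "j < n" "j \<noteq> degree b" "j \<noteq> degree y" for j
        using fun_cong[OF eq_r, of j] that by simp
      \<comment> \<open>Triangular elimination: \<open>y\<close> does not involve coordinate
        \<open>degree b\<close>, so its value fixes coordinate \<open>degree y\<close>; afterwards
        \<open>b\<close> fixes the remaining one.\<close>
      have u_y: "u (degree y) = u' (degree y)"
      proof (rule lin_eval_eqD[OF eq_y deg_F[OF conf(3)]])
        show "coeff y (degree y) \<noteq> 0"
          using conf(4) by simp
        show "coeff y j = 0 \<or> u j = u' j" if "j < n" "j \<noteq> degree y" for j
          using other[OF that(1) _ that(2)] coeff_eq_0[OF conf(5)] by blast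
      qed
      have "u (degree b) = u' (degree b)"
      proof (rule lin_eval_eqD[OF eq_b deg_F[OF conf(2)]])
        show "coeff b (degree b) \<noteq> 0"
          using conf(5) by auto
        show "coeff b j = 0 \<or> u j = u' j" if "j < n" "j \<noteq> degree b" for j
          using other[OF that] u_y by blast
      qed
      then have "u j = u' j" if "j < n" for j
        using other[OF that] u_y by blast
      then show "u = u'"
        by (intro PiE_ext[OF u[unfolded U_def]]) simp
    qed
    moreover have "\<theta> ` U \<subseteq> Sigma K T"
    proof (rule image_subsetI)
      fix u assume u: "u \<in> U"
      define i b y where "i = ci u" and "b = cb u" and "y = cy u"
      have conf: "mono_config I p s F (\<chi> u) i b y"
        using c[OF u] by (simp add: i_def b_def y_def)
      have in_A: "lin_eval n v u \<in> A i" if "v \<in> F" "\<chi> u v = i" for v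
        using \<chi>[OF u that(1)] that(2) by simp
      have "lin_eval n (b + smult (s i) y) u \<in> A i" "lin_eval n b u \<in> A i" "lin_eval n (smult (- p i) y) u \<in> A i"
        using conf in_A[of b] in_A[of "b + smult (s i) y"] in_A[of "smult (- p i) y"]
        unfolding mono_config_def by simp_all
      moreover have "p i * lin_eval n (b + smult (s i) y) u + - p i * lin_eval n b u
          + s i * lin_eval n (smult (- p i) y) u = 0"
        unfolding lin_eval_add lin_eval_smult by (simp add: algebra_simps)
      ultimately have "(lin_eval n (b + smult (s i) y) u, lin_eval n b u, lin_eval n (smult (- p i) y) u) \<in> S i"
        by (simp add: S_def solutions_def)
      moreover have "restrict u ({..<n} - {degree b, degree y}) \<in> {..<n} - {degree b, degree y} \<rightarrow>\<^sub>E P"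
        using u by (auto simp: U_def)
      moreover have "(i, b, y) \<in> K"
        using conf by (simp add: K_def mono_config_def)
      ultimately show "\<theta> u \<in> Sigma K T"
        by (simp add: \<theta>_def T_def i_def b_def y_def)
    qed
    moreover have fin_T: "finite (T k)" if "k \<in> K" for k
      using that fin_S fin_P by (auto simp: T_def K_def intro!: finite_cartesian_product finite_PiE)
    ultimately have "card U \<le> card (Sigma K T)"
      using fin_K by (intro card_inj_on_le) auto
    also have "\<dots> = (\<Sum>k\<in>K. card (T k))"
      using fin_K fin_T by (intro card_SigmaI) auto
    finally have card_U: "card P ^ n \<le> (\<Sum>k\<in>K. card (T k))"
      by (simp add: U_def card_PiE)
    have "card P > 0"
      by (simp add: P_def card_poly_below)
    have card_T: "real (card (T k)) \<le> \<epsilon> * q ^ (2 * N) * real (card P) ^ (n - 2)" and n_ge: "n \<ge> 2" if k: "k \<in> K" for k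
    proof -
      obtain i b y where iby: "k = (i, b, y)"
        by (cases k)
      have conf: "i \<in> I" "b \<in> F" "y \<in> F" "degree y < degree b"
        using k by (auto simp: K_def iby)
      then have "card ({..<n} - {degree b, degree y}) = n - 2"
        using deg_F[OF conf(2)] deg_F[OF conf(3)] by (subst card_Diff_subset) auto
      then have "card (T k) = card (S i) * card P ^ (n - 2)"
        by (simp add: T_def iby card_cartesian_product card_PiE)
      then show "real (card (T k)) \<le> \<epsilon> * q ^ (2 * N) * real (card P) ^ (n - 2)"
        using few[OF conf(1)] by (simp add: S_def mult_right_mono)
      show "n \<ge> 2"
        using conf(4) deg_F[OF conf(2)] by linarith
    qed
    \<comment> \<open>A configuration has degree y < degree b < n, so its existence ensures that
      \<open>n - 2\<close> is not truncated.\<close>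
    have "K \<noteq> {}"
      using card_U \<open>card P > 0\<close> by auto
    then have n: "n \<ge> 2"
      using n_ge by blast
    have "real (card P) ^ 2 * real (card P) ^ (n - 2) = real (card P) ^ (2 + (n - 2))"
      by (simp only: power_add)
    also have "\<dots> = real (card P ^ n)"
      unfolding le_add_diff_inverse[OF n] by simp
    also have "\<dots> \<le> (\<Sum>k\<in>K. real (card (T k)))"
      using card_U by (simp flip: of_nat_sum)
    also have "\<dots> \<le> (\<Sum>k\<in>K. \<epsilon> * q ^ (2 * N) * real (card P) ^ (n - 2))"
      by (intro sum_mono card_T)
    also have "\<dots> = (real (card K) * \<epsilon> * q ^ (2 * N)) * real (card P) ^ (n - 2)"
      by simp
    finally have "real (card P) ^ 2 \<le> real (card K) * \<epsilon> * q ^ (2 * N)"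
      by (rule mult_right_le_imp_le) (use \<open>card P > 0\<close> in simp)
    also have "real (card P) ^ 2 = q ^ (2 * N) / q ^ (2 * M)"
      unfolding P_def card_poly_below of_nat_power q_def[symmetric]
      using N q by (simp add: power_diff power_divide power_even_eq)
    finally have "q ^ (2 * N) * 1 \<le> q ^ (2 * N) * (real (card K) * \<epsilon> * q ^ (2 * M))"
      using q by (simp add: field_simps)
    then have "1 \<le> real (card K) * \<epsilon> * q ^ (2 * M)"
      using q by (simp only: mult_le_cancel_left_pos zero_less_power)
    also have "\<dots> = real (card K) / real (Suc (card I * card F ^ 2))"
      using q by (simp add: \<epsilon>_def)
    also have "\<dots> < 1"
      using card_K by (simp add: divide_less_eq del: of_nat_Suc)
    finally show False
      by simp
  qed
  ultimately show ?thesis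
    by (intro exI[of _ \<epsilon>] exI[of _ M] conjI allI impI) simp_all
qed

section \<open>Subspaces of finite codimension\<close>

text \<open>Diagonal argument with nested infinite sets: the alphabet is finite, so coordinate
  \<open>m\<close> can be made constant on \<open>S (Suc m)\<close>.\<close>

lemma exists_limit_function:
  fixes f :: "nat \<Rightarrow> nat \<Rightarrow> 'b::finite"
  assumes "infinite I"
  shows "\<exists>g. \<forall>m. infinite {n \<in> I. \<forall>j<m. f n j = g j}"
proof -
  have "\<exists>S g. \<forall>m. (infinite (S m) \<and> S m \<subseteq> I) \<and> (S (Suc m) \<subseteq> S m \<and> (\<forall>n\<in>S (Suc m). f n m = g m))"
  proof -
    have step: "\<exists>T. (infinite T \<and> T \<subseteq> I) \<and> (T \<subseteq> S \<and> (\<exists>b. \<forall>n\<in>T. f n m = b))"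
      if S: "infinite S \<and> S \<subseteq> I" for S m
    proof -
      obtain n0 where "infinite {n \<in> S. f n m = f n0 m}"
        using pigeonhole_infinite[of S "\<lambda>n. f n m"] S by (auto intro: finite_subset[OF subset_UNIV])
      then show ?thesis
        using S by (intro exI[of _ "{n \<in> S. f n m = f n0 m}"]) auto
    qed
    obtain S where S: "\<And>m. (infinite (S m) \<and> S m \<subseteq> I) \<and> (S (Suc m) \<subseteq> S m \<and> (\<exists>b. \<forall>n\<in>S (Suc m). f n m = b))"
      using dependent_nat_choice[of "\<lambda>_ S. infinite S \<and> S \<subseteq> I"
          "\<lambda>m S T. T \<subseteq> S \<and> (\<exists>b. \<forall>n\<in>T. f n m = b)"] assms step by blast
    then obtain g where "\<And>m. \<forall>n\<in>S (Suc m). f n m = g m"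
      by metis
    then show ?thesis
      using S by (intro exI[of _ S] exI[of _ g]) simp
  qed
  then obtain S g where S: "\<And>m. infinite (S m)" "\<And>m. S m \<subseteq> I" "\<And>m. S (Suc m) \<subseteq> S m"
    and g: "\<And>m n. n \<in> S (Suc m) \<Longrightarrow> f n m = g m"
    by blast
  have anti: "S m' \<subseteq> S m" if "m \<le> m'" for m m'
    using that S(3) by (rule lift_Suc_antimono_le[rotated])
  have "f n j = g j" if "n \<in> S m" "j < m" for n j m
    using g[of n j] anti[of "Suc j" m] that by auto
  then have "S m \<subseteq> {n \<in> I. \<forall>j<m. f n j = g j}" for m
    using S(2) by blast
  then show ?thesis
    by (intro exI[of _ g] allI infinite_super[OF _ S(1)])
qed

text \<open>The vector \<open>v\<close> spans a complement of the kernel within \<open>V\<close>, so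
  adjoining it to \<open>B\<close> gives a complement of the smaller subspace.\<close>

lemma has_codim_inter_kernel:
  fixes \<phi> :: "'a::field poly \<Rightarrow> 'a"
  assumes V: "has_codim V k"
    and add: "\<And>x y. \<phi> (x + y) = \<phi> x + \<phi> y" and smult: "\<And>a x. \<phi> (smult a x) = a * \<phi> x"
    and v: "v \<in> V" "\<phi> v \<noteq> 0"
  shows "has_codim {x \<in> V. \<phi> x = 0} (Suc k)"
proof -
  obtain B where B: "finite B" "card B = k" "poly_vs.independent B"
      "poly_vs.span B \<inter> V = {0}" "poly_vs.span B + V = UNIV" and sub: "poly_vs.subspace V"
    using V by (auto simp: has_codim_def)
  have \<phi>_0: "\<phi> 0 = 0"
    using smult[of 0 0] by simp
  have "v \<noteq> 0"
    using v(2) \<phi>_0 by auto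
  then have v_span: "v \<notin> poly_vs.span B"
    using B(4) v(1) by blast
  then have "v \<notin> B"
    using poly_vs.span_base by blast
  have "poly_vs.subspace {x \<in> V. \<phi> x = 0}"
    using sub by (auto simp: poly_vs.subspace_def add smult \<phi>_0)
  moreover have "finite (insert v B)" "card (insert v B) = Suc k"
    using B \<open>v \<notin> B\<close> by auto
  moreover have "poly_vs.independent (insert v B)"
    using B(3) v_span \<open>v \<notin> B\<close> by (simp add: poly_vs.independent_insert)
  moreover have "poly_vs.span (insert v B) \<inter> {x \<in> V. \<phi> x = 0} = {0}"
  proof -
    have "x = 0" if x: "x \<in> poly_vs.span (insert v B)" "x \<in> V" "\<phi> x = 0" for x
    proof -
      obtain a where a: "x - smult a v \<in> poly_vs.span B"
        using x(1) by (auto simp: poly_vs.span_insert)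
      moreover have "x - smult a v \<in> V"
        using sub x(2) v(1) by (intro poly_vs.subspace_diff poly_vs.subspace_scale)
      ultimately have "x - smult a v = 0"
        using B(4) by blast
      then have "x = smult a v"
        by simp
      then show ?thesis
        using x(3) v(2) by (simp add: smult)
    qed
    then show ?thesis
      using poly_vs.span_zero[of "insert v B"] sub \<phi>_0 by (auto simp: poly_vs.subspace_def)
  qed
  moreover have "x \<in> poly_vs.span (insert v B) + {x \<in> V. \<phi> x = 0}" for x
  proof -
    obtain b w where bw: "x = b + w" "b \<in> poly_vs.span B" "w \<in> V"
      using B(5) by (metis UNIV_I set_plus_elim)
    define a where "a = \<phi> w / \<phi> v"
    have "x = (b + smult a v) + (w + smult (- a) v)"
      by (simp add: bw(1))
    moreover have "b + smult a v \<in> poly_vs.span (insert v B)"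
      using bw(2) by (auto simp: poly_vs.span_insert intro!: exI[of _ a])
    moreover have "w + smult (- a) v \<in> V"
      using sub bw(3) v(1) by (intro poly_vs.subspace_add poly_vs.subspace_scale)
    moreover have "\<phi> (w + smult (- a) v) = 0"
      using v(2) unfolding add smult a_def by simp
    ultimately show ?thesis
      by (metis (mono_tags, lifting) mem_Collect_eq set_plus_intro)
  qed
  ultimately show ?thesis
    unfolding has_codim_def by (intro conjI exI[of _ "insert v B"]) blast+
qed

text \<open>If the functional vanishes on \<open>V\<close>, any other coefficient functional is used instead, so that
  the codimension is exactly \<open>Suc k\<close>.\<close>

lemma exists_has_codim_Suc:
  fixes \<phi> :: "'a::field poly \<Rightarrow> 'a"
  assumes V: "has_codim V k"
    and add: "\<And>x y. \<phi> (x + y) = \<phi> x + \<phi> y" and smult: "\<And>a x. \<phi> (smult a x) = a * \<phi> x"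
  shows "\<exists>W\<subseteq>V. has_codim W (Suc k) \<and> (\<forall>x\<in>W. \<phi> x = 0)"
proof (cases "\<exists>v\<in>V. \<phi> v \<noteq> 0")
  case True
  then obtain v where "v \<in> V" "\<phi> v \<noteq> 0"
    by blast
  then show ?thesis
    using has_codim_inter_kernel[OF V add smult] by (intro exI[of _ "{x \<in> V. \<phi> x = 0}"]) auto
next
  case False
  obtain B where B: "finite B" "poly_vs.span B + V = UNIV"
    using V by (auto simp: has_codim_def)
  define m where "m = Suc (\<Sum>b\<in>B. degree b)"
  have "B \<subseteq> poly_below m"
    using member_le_sum[of _ B degree] B(1) by (auto simp: poly_below_iff m_def less_Suc_eq_le)
  then have span: "poly_vs.span B \<subseteq> poly_below m"
    by (intro poly_vs.span_minimal) (auto simp: poly_vs.subspace_def poly_below_def)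
  \<comment> \<open>The complement \<open>span B\<close> has bounded degree, so it cannot be the
    whole space.\<close>
  have "V \<noteq> {0}"
  proof
    assume "V = {0}"
    then have "monom 1 m \<in> poly_vs.span B"
      using B(2) by (metis UNIV_I add.right_neutral set_zero singletonD set_plus_elim)
    then have "monom (1::'a) m \<in> poly_below m"
      using span by blast
    then show False
      by (auto simp: poly_below_def)
  qed
  moreover have "0 \<in> V"
    using V by (auto simp: has_codim_def poly_vs.subspace_def)
  ultimately obtain v where v: "v \<in> V" "v \<noteq> 0"
    by blast
  have "has_codim {x \<in> V. coeff x (degree v) = 0} (Suc k)"
    by (rule has_codim_inter_kernel[OF V _ _ v(1)]) (use v(2) in auto)
  moreover have "\<phi> x = 0" if "x \<in> V" for x
    using False that by blast
  ultimately show ?thesis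
    by (intro exI[of _ "{x \<in> V. coeff x (degree v) = 0}"] conjI ballI) simp_all
qed

lemma has_codim_UNIV: "has_codim UNIV 0"
  unfolding has_codim_def
  by (intro conjI exI[of _ "{}"]) (auto simp: poly_vs.subspace_def poly_vs.independent_empty set_plus_def)

text \<open>A row of \<open>c\<close> may have infinitely many nonzero entries, but a polynomial
  meets only those up to its degree; so each row is a functional on the whole space. Each costs
  exactly one dimension, even if the rows are dependent.\<close>

lemma exists_has_codim_in_kernels:
  fixes c :: "nat \<Rightarrow> nat \<Rightarrow> 'a::field"
  shows "\<exists>V. has_codim V k \<and> (\<forall>x\<in>V. \<forall>i<k. (\<Sum>j\<le>degree x. c i j * coeff x j) = 0)"
proof (induction k)
  case 0
  then show ?case
    using has_codim_UNIV by auto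
next
  case (Suc k)
  then obtain V where V: "has_codim V k" "\<And>x i. x \<in> V \<Longrightarrow> i < k \<Longrightarrow> (\<Sum>j\<le>degree x. c i j * coeff x j) = 0"
    by blast
  define \<phi> where "\<phi> x = (\<Sum>j\<le>degree x. c k j * coeff x j)" for x
  \<comment> \<open>The sum may be cut off at any bound on the degree, so \<open>x\<close>,
    \<open>y\<close> and \<open>x + y\<close> can share one.\<close>
  have \<phi>: "\<phi> x = (\<Sum>j\<le>m. c k j * coeff x j)" if "degree x \<le> m" for x m
    unfolding \<phi>_def using that by (intro sum.mono_neutral_left) (auto simp: coeff_eq_0)
  have "\<phi> (x + y) = \<phi> x + \<phi> y" for x y
  proof -
    define m where "m = max (degree x) (degree y)"
    have "degree (x + y) \<le> m" "degree x \<le> m" "degree y \<le> m"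
      by (auto simp: m_def intro: degree_add_le)
    then show ?thesis
      by (simp add: \<phi> sum.distrib[symmetric] distrib_left)
  qed
  moreover have "\<phi> (smult a x) = a * \<phi> x" for a x
    by (simp add: \<phi>[of "smult a x" "degree x"] \<phi>[of x "degree x"] sum_distrib_left mult_ac)
  ultimately obtain W where "W \<subseteq> V" "has_codim W (Suc k)" "\<forall>x\<in>W. \<phi> x = 0"
    using exists_has_codim_Suc[OF V(1), of \<phi>] by blast
  then show ?case
    using V(2) by (intro exI[of _ W]) (auto simp: \<phi>_def less_Suc_eq)
qed

text \<open>A compactness argument: the functionals for the boxes \<open>poly_below N\<close> are determined by finitely
  many values on each box, hence have a limit along a subsequence.\<close>

lemma exists_has_codim_of_functionals:
  fixes S :: "'a::{field,finite} poly set"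
  assumes "\<exists>\<^sub>\<infinity>N. \<exists>c. \<forall>x\<in>poly_below N. (\<forall>i<k. (\<Sum>j<N. c i j * coeff x j) = 0) \<longrightarrow> x \<in> S"
  shows "\<exists>V. has_codim V k \<and> V \<subseteq> S"
proof -
  define I where "I = {N. \<exists>c. \<forall>x\<in>poly_below N. (\<forall>i<k. (\<Sum>j<N. c i j * coeff x j) = 0) \<longrightarrow> x \<in> S}"
  have "infinite I"
    using assms by (simp add: I_def INFM_iff_infinite)
  have "\<forall>N\<in>I. \<exists>c. \<forall>x\<in>poly_below N. (\<forall>i<k. (\<Sum>j<N. c i j * coeff x j) = 0) \<longrightarrow> x \<in> S"
    by (simp add: I_def)
  from bchoice[OF this] obtain c where "\<forall>N\<in>I. \<forall>x\<in>poly_below N.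
      (\<forall>i<k. (\<Sum>j<N. c N i j * coeff x j) = 0) \<longrightarrow> x \<in> S"
    ..
  then have c: "x \<in> S" if "N \<in> I" "x \<in> poly_below N"
      "\<And>i. i < k \<Longrightarrow> (\<Sum>j<N. c N i j * coeff x j) = 0" for N x
    using that by simp
  \<comment> \<open>Pairs of indices are coded as numbers to fit the diagonal argument for
    sequences.\<close>
  obtain g where g: "\<And>m. infinite {N \<in> I. \<forall>l<m. case_prod (c N) (prod_decode l) = g l}"
    using exists_limit_function[OF \<open>infinite I\<close>, of "\<lambda>N l. case_prod (c N) (prod_decode l)"] by blast
  define d where "d i j = g (prod_encode (i, j))" for i j
  obtain V where V: "has_codim V k" "\<And>x i. x \<in> V \<Longrightarrow> i < k \<Longrightarrow> (\<Sum>j\<le>degree x. d i j * coeff x j) = 0"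
    using exists_has_codim_in_kernels[of k d] by blast
  have "x \<in> S" if "x \<in> V" for x
  proof -
    \<comment> \<open>Exceeds the codes of all entries that \<open>x\<close> meets, so agreement
      below \<open>m\<close> gives the limiting functionals at \<open>x\<close>.\<close>
    define m where "m = Suc (\<Sum>l\<in>{..<k} \<times> {..degree x}. prod_encode l)"
    obtain N where N: "N \<in> I" "degree x < N" "\<And>l. l < m \<Longrightarrow> case_prod (c N) (prod_decode l) = g l"
      using g[of m] unfolding infinite_nat_iff_unbounded by blast
    have eq: "c N i j = d i j" if "i < k" "j \<le> degree x" for i j
    proof -
      have "prod_encode (i, j) < m"
        unfolding m_def less_Suc_eq_le using that by (intro member_le_sum) auto
      from N(3)[OF this] show ?thesis
        by (simp add: d_def)
    qed
    show ?thesis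
    proof (rule c[OF N(1)])
      fix i assume "i < k"
      have "(\<Sum>j<N. c N i j * coeff x j) = (\<Sum>j\<le>degree x. d i j * coeff x j)"
        using N(2) eq[OF \<open>i < k\<close>] by (intro sum.mono_neutral_cong_right) (auto simp: coeff_eq_0)
      then show "(\<Sum>j<N. c N i j * coeff x j) = 0"
        using V(2)[OF that \<open>i < k\<close>] by simp
    qed (use N(2) in \<open>simp add: poly_below_iff\<close>)
  qed
  then show ?thesis
    using V(1) by blast
qed

section \<open>From solution counts to subspaces\<close>

lemma solutions_mono: "A \<subseteq> B \<Longrightarrow> solutions s1 s2 s3 A x \<subseteq> solutions s1 s2 s3 B x"
  by (auto simp: solutions_def)

text \<open>The codimension depends only on the coefficients and \<epsilon>. Infinitely many
  \<open>N\<close> suffice, which is all that a limsup or a pigeonhole over the colours can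
  offer.\<close>

lemma exists_has_codim_of_many_solutions:
  fixes s1 s2 s3 :: "'a::{field,finite} poly" and \<epsilon> :: real
  assumes s: "s1 \<noteq> 0" "s2 \<noteq> 0" "s3 \<noteq> 0" and "\<epsilon> > 0"
  shows "\<exists>k. \<forall>A. (\<exists>\<^sub>\<infinity>N. \<epsilon> * real CARD('a) ^ (2 * N) \<le> real (card (solutions s1 s2 s3 (A \<inter> poly_below N) 0)))
    \<longrightarrow> (\<exists>V. has_codim V k \<and> V \<subseteq> {x. solutions s1 s2 s3 A x \<noteq> {}})"
proof -
  obtain k :: nat where k: "\<forall>N A. A \<subseteq> poly_below N \<longrightarrow>
      \<epsilon> * real CARD('a) ^ (2 * N) \<le> real (card (solutions s1 s2 s3 A 0)) \<longrightarrow>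
      (\<exists>c. \<forall>x\<in>poly_below N. (\<forall>i<k. (\<Sum>j<N. c i j * coeff x j) = 0) \<longrightarrow> solutions s1 s2 s3 A x \<noteq> {})"
    using exists_functionals_of_many_solutions[OF s \<open>\<epsilon> > 0\<close>] ..
  show ?thesis
  proof (intro exI[of _ k] allI impI exists_has_codim_of_functionals)
    fix A
    assume "\<exists>\<^sub>\<infinity>N. \<epsilon> * real CARD('a) ^ (2 * N) \<le> real (card (solutions s1 s2 s3 (A \<inter> poly_below N) 0))"
    then show "\<exists>\<^sub>\<infinity>N. \<exists>c. \<forall>x\<in>poly_below N. (\<forall>i<k. (\<Sum>j<N. c i j * coeff x j) = 0) \<longrightarrow>
        x \<in> {x. solutions s1 s2 s3 A x \<noteq> {}}"
    proof (rule INFM_mono)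
      fix N
      assume "\<epsilon> * real CARD('a) ^ (2 * N) \<le> real (card (solutions s1 s2 s3 (A \<inter> poly_below N) 0))"
      then have "\<exists>c. \<forall>x\<in>poly_below N. (\<forall>i<k. (\<Sum>j<N. c i j * coeff x j) = 0) \<longrightarrow>
          solutions s1 s2 s3 (A \<inter> poly_below N) x \<noteq> {}"
        by (rule k[rule_format, rotated]) simp
      then obtain c where "\<forall>x\<in>poly_below N. (\<forall>i<k. (\<Sum>j<N. c i j * coeff x j) = 0) \<longrightarrow>
          solutions s1 s2 s3 (A \<inter> poly_below N) x \<noteq> {}"
        ..
      moreover have "solutions s1 s2 s3 (A \<inter> poly_below N) x \<subseteq> solutions s1 s2 s3 A x" for x
        by (intro solutions_mono) simp
      ultimately show "\<exists>c. \<forall>x\<in>poly_below N. (\<forall>i<k. (\<Sum>j<N. c i j * coeff x j) = 0) \<longrightarrow>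
          x \<in> {x. solutions s1 s2 s3 A x \<noteq> {}}"
        by (intro exI[of _ c]) blast
    qed
  qed
qed

lemma exists_has_codim_of_upper_density:
  fixes s1 s2 s3 :: "'a::{field,finite} poly"
  assumes s: "s1 \<noteq> 0" "s2 \<noteq> 0" "s3 \<noteq> 0" "s1 + s2 + s3 = 0" and "\<delta> > (0::real)"
  shows "\<exists>k. \<forall>A. upper_density A = ereal \<delta> \<longrightarrow>
    (\<exists>V. has_codim V k \<and> V \<subseteq> s1 *o A + s2 *o A + s3 *o A)"
proof -
  obtain \<epsilon> N0 where "\<epsilon> > 0" and \<epsilon>: "\<forall>N\<ge>N0. \<forall>A\<subseteq>poly_below N. \<delta> / 2 * real CARD('a) ^ N \<le> real (card A) \<longrightarrow>
      \<epsilon> * real CARD('a) ^ (2 * N) \<le> real (card (solutions s1 s2 s3 A 0))"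
    using many_solutions_of_dense[OF s, of "\<delta> / 2"] \<open>\<delta> > 0\<close> by auto
  obtain k where k: "\<forall>A. (\<exists>\<^sub>\<infinity>N. \<epsilon> * real CARD('a) ^ (2 * N) \<le> real (card (solutions s1 s2 s3 (A \<inter> poly_below N) 0)))
      \<longrightarrow> (\<exists>V. has_codim V k \<and> V \<subseteq> {x. solutions s1 s2 s3 A x \<noteq> {}})"
    using exists_has_codim_of_many_solutions[OF s(1-3) \<open>\<epsilon> > 0\<close>] ..
  show ?thesis
  proof (intro exI[of _ k] allI impI)
    fix A :: "'a poly set" assume A: "upper_density A = ereal \<delta>"
    have box: "{x \<in> A. x = 0 \<or> degree x < N} = A \<inter> poly_below N" for N
      by (auto simp: poly_below_iff)
    \<comment> \<open>If the density were eventually below \<open>\<delta> / 2\<close>, so would be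
      its limsup.\<close>
    have "\<exists>\<^sub>\<infinity>N. \<delta> / 2 * real CARD('a) ^ N \<le> real (card (A \<inter> poly_below N))"
    proof (rule ccontr)
      assume "\<not> ?thesis"
      then have "\<forall>\<^sub>F N in sequentially. \<not> \<delta> / 2 * real CARD('a) ^ N \<le> real (card (A \<inter> poly_below N))"
        by (simp add: frequently_def cofinite_eq_sequentially)
      then have "\<forall>\<^sub>F N in sequentially.
          ereal (real (card (A \<inter> poly_below N)) / real CARD('a) ^ N) \<le> ereal (\<delta> / 2)"
        by (rule eventually_mono) (simp add: field_simps)
      then have "upper_density A \<le> ereal (\<delta> / 2)"
        unfolding upper_density_def box by (rule Limsup_bounded)
      then show False
        using A \<open>\<delta> > 0\<close> by simp
    qed
    then have "\<exists>\<^sub>\<infinity>N. \<delta> / 2 * real CARD('a) ^ N \<le> real (card (A \<inter> poly_below N)) \<and> N0 \<le> N"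
      by (rule frequently_eventually_frequently) (rule MOST_ge_nat)
    then have "\<exists>\<^sub>\<infinity>N. \<epsilon> * real CARD('a) ^ (2 * N) \<le> real (card (solutions s1 s2 s3 (A \<inter> poly_below N) 0))"
      by (rule INFM_mono) (use \<epsilon> in auto)
    then obtain V where "has_codim V k" "V \<subseteq> {x. solutions s1 s2 s3 A x \<noteq> {}}"
      using k by blast
    moreover have "{x. solutions s1 s2 s3 A x \<noteq> {}} \<subseteq> s1 *o A + s2 *o A + s3 *o A"
      by (force simp: solutions_def set_plus_def elt_set_times_def)
    ultimately show "\<exists>V. has_codim V k \<and> V \<subseteq> s1 *o A + s2 *o A + s3 *o A"
      by blast
  qed
qed

text \<open>Lets colours with different codimensions share a common value.\<close>

lemma has_codim_increase:
  assumes "k \<le> k'" "has_codim V k"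
  shows "\<exists>W\<subseteq>V. has_codim W k'"
  using assms(1)
proof (induction rule: dec_induct)
  case base
  then show ?case
    using assms(2) by blast
next
  case (step l)
  then obtain W where "W \<subseteq> V" "has_codim W l"
    by blast
  moreover from exists_has_codim_Suc[OF this(2), of "\<lambda>_. 0"] obtain W' where "W' \<subseteq> W" "has_codim W' (Suc l)"
    by auto
  ultimately show ?case
    by blast
qed

text \<open>Each large \<open>N\<close> has a colour with many solutions, and one colour recurs for
  infinitely many \<open>N\<close>. Constant families \<open>p\<close>, \<open>s\<close> give (b);
  \<open>p i = 1\<close> with varying \<open>s i\<close> gives (c).\<close>

lemma exists_has_codim_of_cover:
  fixes p s :: "'c \<Rightarrow> 'a::{field,finite} poly"
  assumes "finite I" and p: "\<And>i. i \<in> I \<Longrightarrow> p i \<noteq> 0" and s: "\<And>i. i \<in> I \<Longrightarrow> s i \<noteq> 0"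
  shows "\<exists>k. \<forall>A. (\<Union>i\<in>I. A i) = UNIV \<longrightarrow>
    (\<exists>i\<in>I. \<exists>V. has_codim V k \<and> V \<subseteq> p i *o A i -\<^sub>S p i *o A i + s i *o A i)"
proof -
  obtain \<epsilon> N0 where "\<epsilon> > 0" and \<epsilon>: "\<forall>N\<ge>N0. \<forall>A. (\<forall>i\<in>I. A i \<subseteq> poly_below N) \<longrightarrow>
      poly_below N \<subseteq> (\<Union>i\<in>I. A i) \<longrightarrow>
      (\<exists>i\<in>I. \<epsilon> * real CARD('a) ^ (2 * N) \<le> real (card (solutions (p i) (- p i) (s i) (A i) 0)))"
    using many_solutions_of_colouring[where I = I and p = p and s = s, OF assms(1) p] by auto
  have "\<forall>i\<in>I. \<exists>k. \<forall>A. (\<exists>\<^sub>\<infinity>N. \<epsilon> * real CARD('a) ^ (2 * N)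
      \<le> real (card (solutions (p i) (- p i) (s i) (A \<inter> poly_below N) 0)))
      \<longrightarrow> (\<exists>V. has_codim V k \<and> V \<subseteq> {x. solutions (p i) (- p i) (s i) A x \<noteq> {}})"
    using p s by (intro ballI exists_has_codim_of_many_solutions \<open>\<epsilon> > 0\<close>) auto
  from bchoice[OF this] obtain k where k: "\<forall>i\<in>I. \<forall>A. (\<exists>\<^sub>\<infinity>N. \<epsilon> * real CARD('a) ^ (2 * N)
      \<le> real (card (solutions (p i) (- p i) (s i) (A \<inter> poly_below N) 0)))
      \<longrightarrow> (\<exists>V. has_codim V (k i) \<and> V \<subseteq> {x. solutions (p i) (- p i) (s i) A x \<noteq> {}})"
    ..
  show ?thesis
  \<comment> \<open>The recurring colour depends on \<open>A\<close> but the codimension must not;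
    the sum dominates every \<open>k i\<close>.\<close>
  proof (intro exI[of _ "\<Sum>i\<in>I. k i"] allI impI)
    fix A :: "'c \<Rightarrow> 'a poly set" assume A: "(\<Union>i\<in>I. A i) = UNIV"
    have "\<exists>i\<in>I. \<epsilon> * real CARD('a) ^ (2 * N)
        \<le> real (card (solutions (p i) (- p i) (s i) (A i \<inter> poly_below N) 0))" if "N \<ge> N0" for N
      using \<epsilon>[rule_format, of N "\<lambda>i. A i \<inter> poly_below N"] that A by blast
    then have "\<exists>\<^sub>\<infinity>N. \<exists>i\<in>I. \<epsilon> * real CARD('a) ^ (2 * N)
        \<le> real (card (solutions (p i) (- p i) (s i) (A i \<inter> poly_below N) 0))"
      unfolding INFM_nat_le by (meson max.cobounded1 max.cobounded2)
    then obtain i where i: "i \<in> I" "\<exists>\<^sub>\<infinity>N. \<epsilon> * real CARD('a) ^ (2 * N)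
        \<le> real (card (solutions (p i) (- p i) (s i) (A i \<inter> poly_below N) 0))"
      unfolding INFM_finite_Bex_distrib[OF \<open>finite I\<close>] by blast
    then obtain V where V: "has_codim V (k i)" "V \<subseteq> {x. solutions (p i) (- p i) (s i) (A i) x \<noteq> {}}"
      using k by blast
    moreover have "k i \<le> (\<Sum>i\<in>I. k i)"
      using i(1) \<open>finite I\<close> by (intro member_le_sum) auto
    then obtain W where "W \<subseteq> V" "has_codim W (\<Sum>i\<in>I. k i)"
      using has_codim_increase V(1) by blast
    moreover have "{x. solutions (p i) (- p i) (s i) (A i) x \<noteq> {}} \<subseteq> p i *o A i -\<^sub>S p i *o A i + s i *o A i"
    proof
      fix x assume "x \<in> {x. solutions (p i) (- p i) (s i) (A i) x \<noteq> {}}"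
      then obtain a b c where "(a, b, c) \<in> solutions (p i) (- p i) (s i) (A i) x"
        by auto
      then have "x = (p i * a - p i * b) + s i * c" "a \<in> A i" "b \<in> A i" "c \<in> A i"
        by (auto simp: solutions_def)
      then show "x \<in> p i *o A i -\<^sub>S p i *o A i + s i *o A i"
        unfolding set_minus_def elt_set_times_def by (auto intro!: set_plus_intro)
    qed
    ultimately show "\<exists>i\<in>I. \<exists>V. has_codim V (\<Sum>i\<in>I. k i) \<and> V \<subseteq> p i *o A i -\<^sub>S p i *o A i + s i *o A i"
      using i(1) by blast
  qed
qed

theorem theorem1p10:
  fixes s1 s2 s3 :: "'a::{field,finite} poly"
  assumes "s1 \<noteq> 0" and "s2 \<noteq> 0" and "s3 \<noteq> 0" and "s1 + s2 + s3 = 0"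
  shows
    "(\<forall>\<delta>::real. \<delta> > 0 \<longrightarrow>
       (\<exists>k. \<forall>A. upper_density A = ereal \<delta> \<longrightarrow>
          (\<exists>V. has_codim V k \<and> V \<subseteq> s1 *o A + s2 *o A + s3 *o A)))
   \<and> (\<forall>r::nat. \<exists>k. \<forall>A :: nat \<Rightarrow> 'a poly set. (\<Union>i\<in>{1..r}. A i) = UNIV \<longrightarrow>
       (\<exists>i\<in>{1..r}. \<exists>V. has_codim V k \<and> V \<subseteq> s1 *o A i -\<^sub>S s1 *o A i + s2 *o A i))
   \<and> (\<forall>(r::nat) (A :: nat \<Rightarrow> 'a poly set). (\<Union>i\<in>{1..r}. A i) = UNIV \<longrightarrow>
       (\<exists>i\<in>{1..r}. \<forall>s. s \<noteq> 0 \<longrightarrow>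
          (\<exists>k V. has_codim V k \<and> V \<subseteq> A i -\<^sub>S A i + s *o A i)))"
proof (intro conjI allI impI)
  fix \<delta> :: real assume "\<delta> > 0"
  then show "\<exists>k. \<forall>A. upper_density A = ereal \<delta> \<longrightarrow>
      (\<exists>V. has_codim V k \<and> V \<subseteq> s1 *o A + s2 *o A + s3 *o A)"
    using assms by (intro exists_has_codim_of_upper_density)
next
  fix r :: nat
  show "\<exists>k. \<forall>A :: nat \<Rightarrow> 'a poly set. (\<Union>i\<in>{1..r}. A i) = UNIV \<longrightarrow>
       (\<exists>i\<in>{1..r}. \<exists>V. has_codim V k \<and> V \<subseteq> s1 *o A i -\<^sub>S s1 *o A i + s2 *o A i)"
    using assms by (intro exists_has_codim_of_cover) auto
next
  fix r :: nat and A :: "nat \<Rightarrow> 'a poly set"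
  assume A: "(\<Union>i\<in>{1..r}. A i) = UNIV"
  show "\<exists>i\<in>{1..r}. \<forall>s. s \<noteq> 0 \<longrightarrow> (\<exists>k V. has_codim V k \<and> V \<subseteq> A i -\<^sub>S A i + s *o A i)"
  proof (rule ccontr)
    assume "\<not> ?thesis"
    then have "\<forall>i\<in>{1..r}. \<exists>s. s \<noteq> 0 \<and> \<not> (\<exists>k V. has_codim V k \<and> V \<subseteq> A i -\<^sub>S A i + s *o A i)"
      by blast
    from bchoice[OF this] obtain s where s: "\<forall>i\<in>{1..r}. s i \<noteq> 0 \<and>
        \<not> (\<exists>k V. has_codim V k \<and> V \<subseteq> A i -\<^sub>S A i + s i *o A i)"
      ..
    have one: "(1 :: 'a poly) *o B = B" for B
      by (auto simp: elt_set_times_def)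
    \<comment> \<open>This codimension depends on the family \<open>s\<close>, hence on the
      covering; (c) asks for no uniformity.\<close>
    have "\<exists>k. \<forall>A. (\<Union>i\<in>{1..r}. A i) = UNIV \<longrightarrow> (\<exists>i\<in>{1..r}. \<exists>V. has_codim V k \<and>
        V \<subseteq> 1 *o A i -\<^sub>S 1 *o A i + s i *o A i)"
      using s by (intro exists_has_codim_of_cover) auto
    then show False
      using s A unfolding one by blast
  qed
qed

end
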